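(* Let $(W,S)$ be a Coxeter system, $Q=(\sigma_1,\ldots,\sigma_n)$ a word of size $n$ in $S$, $\pi\in W$ an element contained in $Q$, and $\Delta=\Delta(Q,\pi)$ the subword complex. Let $k$ be a field. Then the projective dimension of the ideal $I_{\Delta^{\vee}}$, as a module over $k[x_1,\ldots,x_n]$, satisfies $\mathrm{proj\,dim}(I_{\Delta^{\vee}})\le n-\ell(\pi)$.
   Context: A word $Q=(\sigma_1,\ldots,\sigma_n)$ of size $n$ is an ordered sequence of elements of the set $S$ of simple reflections. A subword $P$ of $Q$ is an ordered subsequence, identified with its set of positions in $[n]=\{1,\ldots,n\}$. $P$ represents $\pi$ if the ordered product of the simple reflections in $P$ is a reduced expression for $\pi$; $P$ contains $\pi$ if some subsequence of $P$ represents $\pi$. The subword complex $\Delta(Q,\pi)$ is the simplicial complex (on the $n$ positions of $Q$) of all subwords $Q\setminus P$ such that $P$ contains $\pi$. $\ell$ is the length function of $(W,S)$. For a subword $P=(\sigma_{i_1},\ldots,\sigma_{i_m})$ of $Q$ put $\mathbf{x}_P=x_{i_1}\cdots x_{i_m}$. The Stanley--Reisner ideal of the Alexander dual of $\Delta=\Delta(Q,\pi)$ is $I_{\Delta^\vee}=(\mathbf{x}_P\mid P\subseteq Q,\ P\text{ represents }\pi)\subseteq k[x_1,\ldots,x_n]$. *)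

theory Defs
  imports "HOL-Algebra.Module" "HOL-Algebra.Ideal" "HOL-Algebra.AbelCoset"
    "HOL-Library.Poly_Mapping" "HOL-Library.Extended_Nat"
begin

section \<open>Coxeter systems\<close>

definition word_prod :: "('w, 'b) monoid_scheme \<Rightarrow> 'w list \<Rightarrow> 'w" where
  "word_prod W ws = foldr (mult W) ws (one W)"

definition coxeter_matrix_on :: "'w set \<Rightarrow> ('w \<Rightarrow> 'w \<Rightarrow> enat) \<Rightarrow> bool" where
  "coxeter_matrix_on S m \<longleftrightarrow>
     (\<forall>s\<in>S. \<forall>t\<in>S. m s t = m t s \<and> m s t \<noteq> 0 \<and> (m s t = 1 \<longleftrightarrow> s = t))"

text \<open>Equality of group words in the group presented by the generators \<open>S\<close> and the relations
  \<open>(s t)^(m s t) = 1\<close> for \<open>m s t < \<infinity>\<close>.  A letter \<open>(s, True)\<close> stands for \<open>s\<close> and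
  \<open>(s, False)\<close> for the formal inverse of \<open>s\<close>, so that words modulo the rule \<open>cancel\<close> alone
  form the free group on \<open>S\<close>.\<close>

inductive presentation_eq ::
    "'w set \<Rightarrow> ('w \<Rightarrow> 'w \<Rightarrow> enat) \<Rightarrow> ('w \<times> bool) list \<Rightarrow> ('w \<times> bool) list \<Rightarrow> bool"
  for S :: "'w set" and m :: "'w \<Rightarrow> 'w \<Rightarrow> enat" where
  refl: "u \<in> lists (S \<times> UNIV) \<Longrightarrow> presentation_eq S m u u"
| sym: "presentation_eq S m u v \<Longrightarrow> presentation_eq S m v u"
| trans: "presentation_eq S m u v \<Longrightarrow> presentation_eq S m v w \<Longrightarrow> presentation_eq S m u w"
| cancel: "u \<in> lists (S \<times> UNIV) \<Longrightarrow> v \<in> lists (S \<times> UNIV) \<Longrightarrow> s \<in> S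
    \<Longrightarrow> presentation_eq S m (u @ [(s, b), (s, \<not> b)] @ v) (u @ v)"
| relation: "u \<in> lists (S \<times> UNIV) \<Longrightarrow> v \<in> lists (S \<times> UNIV) \<Longrightarrow> s \<in> S \<Longrightarrow> t \<in> S
    \<Longrightarrow> m s t = enat k
    \<Longrightarrow> presentation_eq S m (u @ concat (replicate k [(s, True), (t, True)]) @ v) (u @ v)"

definition letter_value :: "('w, 'b) monoid_scheme \<Rightarrow> 'w \<times> bool \<Rightarrow> 'w" where
  "letter_value W l = (if snd l then fst l else inv\<^bsub>W\<^esub> (fst l))"

text \<open>\<open>(W, S)\<close> is a Coxeter system: the canonical map from the presented group to \<open>W\<close> is
  well defined and injective (last clause) and surjective (\<open>S\<close> generates \<open>W\<close>).
  \<open>S\<close> need not be finite.\<close>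

definition coxeter_system :: "('w, 'b) monoid_scheme \<Rightarrow> 'w set \<Rightarrow> bool" where
  "coxeter_system W S \<longleftrightarrow>
     group W \<and> S \<subseteq> carrier W \<and>
     (\<forall>w\<in>carrier W. \<exists>u\<in>lists (S \<times> UNIV). word_prod W (map (letter_value W) u) = w) \<and>
     (\<exists>m. coxeter_matrix_on S m \<and>
        (\<forall>u\<in>lists (S \<times> UNIV). \<forall>v\<in>lists (S \<times> UNIV).
           word_prod W (map (letter_value W) u) = word_prod W (map (letter_value W) v)
           \<longleftrightarrow> presentation_eq S m u v))"

definition coxeter_length :: "('w, 'b) monoid_scheme \<Rightarrow> 'w set \<Rightarrow> 'w \<Rightarrow> nat" where
  "coxeter_length W S w = (LEAST k. \<exists>ws\<in>lists S. length ws = k \<and> word_prod W ws = w)"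


section \<open>Subword complexes\<close>

text \<open>Positions in a word of size \<open>n\<close>, and likewise the variables of the polynomial ring below,
  are numbered \<open>0, \<dots>, n - 1\<close>, in accordance with \<^const>\<open>nths\<close>.\<close>

definition represents :: "('w, 'b) monoid_scheme \<Rightarrow> 'w set \<Rightarrow> 'w list \<Rightarrow> nat set \<Rightarrow> 'w \<Rightarrow> bool" where
  "represents W S Q P w \<longleftrightarrow>
     P \<subseteq> {..<length Q} \<and> word_prod W (nths Q P) = w \<and>
     length (nths Q P) = coxeter_length W S w"

definition subword_contains :: "('w, 'b) monoid_scheme \<Rightarrow> 'w set \<Rightarrow> 'w list \<Rightarrow> nat set \<Rightarrow> 'w \<Rightarrow> bool" where
  "subword_contains W S Q P w \<longleftrightarrow>
     P \<subseteq> {..<length Q} \<and> (\<exists>P'\<subseteq>P. represents W S Q P' w)"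

definition subword_complex :: "('w, 'b) monoid_scheme \<Rightarrow> 'w set \<Rightarrow> 'w list \<Rightarrow> 'w \<Rightarrow> nat set set" where
  "subword_complex W S Q w = {{..<length Q} - P | P. subword_contains W S Q P w}"

text \<open>The Alexander dual of a simplicial complex on the vertex set \<open>{0, \<dots>, n - 1}\<close> consists of
  the complements of its nonfaces.\<close>

definition alexander_dual :: "nat \<Rightarrow> nat set set \<Rightarrow> nat set set" where
  "alexander_dual n \<Delta> = {F. F \<subseteq> {..<n} \<and> {..<n} - F \<notin> \<Delta>}"


section \<open>Polynomial rings and Stanley--Reisner ideals\<close>

text \<open>Polynomials in the variables \<open>x 0, \<dots>, x (n - 1)\<close> over a field, as a subring of the
  polynomials in countably many variables.\<close>

definition mpoly_ring :: "nat \<Rightarrow> ((nat \<Rightarrow>\<^sub>0 nat) \<Rightarrow>\<^sub>0 'k::field) ring" where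
  "mpoly_ring n =
     \<lparr>carrier = {p. \<forall>m\<in>Poly_Mapping.keys p. Poly_Mapping.keys m \<subseteq> {..<n}},
      mult = (*), one = 1, zero = 0, add = (+)\<rparr>"

definition pvar :: "nat \<Rightarrow> (nat \<Rightarrow>\<^sub>0 nat) \<Rightarrow>\<^sub>0 'k::field" where
  "pvar i = Poly_Mapping.single (Poly_Mapping.single i 1) 1"

definition xmonom :: "nat set \<Rightarrow> (nat \<Rightarrow>\<^sub>0 nat) \<Rightarrow>\<^sub>0 'k::field" where
  "xmonom P = (\<Prod>i\<in>P. pvar i)"

definition stanley_reisner_ideal :: "nat \<Rightarrow> nat set set \<Rightarrow> ((nat \<Rightarrow>\<^sub>0 nat) \<Rightarrow>\<^sub>0 'k::field) set" where
  "stanley_reisner_ideal n \<Delta> = genideal (mpoly_ring n) {xmonom F | F. F \<subseteq> {..<n} \<and> F \<notin> \<Delta>}"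


section \<open>Projective dimension\<close>

text \<open>The records for modules extend those for rings; the fields \<^const>\<open>mult\<close> and \<^const>\<open>one\<close>
  of a module play no role.\<close>

definition ideal_module :: "('r, 'b) ring_scheme \<Rightarrow> 'r set \<Rightarrow> ('r, 'r) module" where
  "ideal_module R I =
     \<lparr>carrier = I, mult = mult R, one = one R, zero = zero R, add = add R, smult = mult R\<rparr>"

definition module_hom ::
    "('r, 'b) ring_scheme \<Rightarrow> ('r, 'm, 'c) module_scheme \<Rightarrow> ('r, 'n, 'd) module_scheme
      \<Rightarrow> ('m \<Rightarrow> 'n) set" where
  "module_hom R M N =
     {f \<in> carrier M \<rightarrow> carrier N.
        (\<forall>x\<in>carrier M. \<forall>y\<in>carrier M. f (x \<oplus>\<^bsub>M\<^esub> y) = f x \<oplus>\<^bsub>N\<^esub> f y) \<and>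
        (\<forall>a\<in>carrier R. \<forall>x\<in>carrier M. f (a \<odot>\<^bsub>M\<^esub> x) = a \<odot>\<^bsub>N\<^esub> f x)}"

text \<open>The free module on a set \<open>X\<close>: finitely supported functions on \<open>X\<close>, extended by zero.\<close>

definition free_module :: "('r, 'b) ring_scheme \<Rightarrow> 'x set \<Rightarrow> ('r, 'x \<Rightarrow> 'r) module" where
  "free_module R X =
     \<lparr>carrier = {f. (\<forall>x. f x \<in> carrier R) \<and> (\<forall>x. x \<notin> X \<longrightarrow> f x = \<zero>\<^bsub>R\<^esub>) \<and>
                  finite {x. f x \<noteq> \<zero>\<^bsub>R\<^esub>}},
      mult = (\<lambda>f g x. f x \<otimes>\<^bsub>R\<^esub> g x), one = (\<lambda>x. \<one>\<^bsub>R\<^esub>),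
      zero = (\<lambda>x. \<zero>\<^bsub>R\<^esub>), add = (\<lambda>f g x. f x \<oplus>\<^bsub>R\<^esub> g x),
      smult = (\<lambda>a f x. a \<otimes>\<^bsub>R\<^esub> f x)\<rparr>"

text \<open>A projective module is a direct summand of a free module, i.e.\ there are
  homomorphisms \<open>P \<rightarrow> F \<rightarrow> P\<close> with \<open>F\<close> free whose composition is the identity.  Drawing the basis
  of \<open>F\<close> from the type \<open>'p\<close> of elements of \<open>P\<close> is no restriction, since
  the free module on the underlying set of \<open>P\<close> maps onto \<open>P\<close>.\<close>

definition projective_module :: "('r, 'b) ring_scheme \<Rightarrow> ('r, 'p, 'c) module_scheme \<Rightarrow> bool" where
  "projective_module R P \<longleftrightarrow>
     Module.module R P \<and>
     (\<exists>(X :: 'p set) i r. i \<in> module_hom R P (free_module R X) \<and>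
        r \<in> module_hom R (free_module R X) P \<and> (\<forall>x\<in>carrier P. r (i x) = x))"

text \<open>An exact sequence \<open>0 \<rightarrow> P d \<rightarrow> \<dots> \<rightarrow> P 1 \<rightarrow> P 0 \<rightarrow> M \<rightarrow> 0\<close> with \<open>P 0, \<dots>, P d\<close> projective,
  continued by zero modules, with augmentation \<open>e\<close> and differentials
  \<open>\<delta> i : P (i + 1) \<rightarrow> P i\<close>.\<close>

definition projective_resolution ::
    "('r, 'b) ring_scheme \<Rightarrow> ('r, 'm, 'c) module_scheme \<Rightarrow> nat
      \<Rightarrow> (nat \<Rightarrow> ('r, 'p) module) \<Rightarrow> (nat \<Rightarrow> 'p \<Rightarrow> 'p) \<Rightarrow> ('p \<Rightarrow> 'm) \<Rightarrow> bool" where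
  "projective_resolution R M d P \<delta> e \<longleftrightarrow>
     (\<forall>i. projective_module R (P i)) \<and>
     (\<forall>i>d. carrier (P i) = {\<zero>\<^bsub>P i\<^esub>}) \<and>
     e \<in> module_hom R (P 0) M \<and> e ` carrier (P 0) = carrier M \<and>
     (\<forall>i. \<delta> i \<in> module_hom R (P (Suc i)) (P i)) \<and>
     \<delta> 0 ` carrier (P 1) = a_kernel (P 0) M e \<and>
     (\<forall>i. \<delta> (Suc i) ` carrier (P (Suc (Suc i))) = a_kernel (P (Suc i)) (P i) (\<delta> i))"

text \<open>The infimum of the lengths of all projective resolutions (\<open>\<infinity>\<close> if there is no finite one).
  The modules of a resolution are taken from the type \<open>'m \<times> nat \<Rightarrow> 'r\<close>.  This is no restriction:
  if \<open>M\<close> has a projective resolution of length \<open>d\<close>, then it has one (given by free modules and,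
  in degree \<open>d\<close>, a syzygy) whose modules have cardinality at most that of \<open>R\<close>, \<open>M\<close> or
  \<open>nat\<close>, whichever is largest, and hence embed as sets into that type
  (for the zero ring all modules vanish).  The zero module gets the value \<open>0\<close>.\<close>

definition proj_dim :: "('r, 'b) ring_scheme \<Rightarrow> ('r, 'm, 'c) module_scheme \<Rightarrow> enat" where
  "proj_dim R M =
     Inf {enat d | d. \<exists>(P :: nat \<Rightarrow> ('r, 'm \<times> nat \<Rightarrow> 'r) module) \<delta> e.
                        projective_resolution R M d P \<delta> e}"


lemma (in cring) ideal_module_module:
  assumes "ideal I R"
  shows "Module.module R (ideal_module R I)"
proof -
  interpret I: ideal I R by fact
  show ?thesis
  proof (rule moduleI)
    show "abelian_group (ideal_module R I)"
    proof (rule abelian_groupI)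
      fix x assume x: "x \<in> carrier (ideal_module R I)"
      then show "\<exists>y\<in>carrier (ideal_module R I).
          y \<oplus>\<^bsub>ideal_module R I\<^esub> x = \<zero>\<^bsub>ideal_module R I\<^esub>"
        by (intro bexI[of _ "\<ominus> x"]) (auto simp: ideal_module_def l_neg I.a_Hcarr)
    qed (auto simp: ideal_module_def I.a_Hcarr a_ac)
  qed (auto simp: ideal_module_def I.a_Hcarr I.I_l_closed l_distr r_distr m_assoc is_cring)
qed


section \<open>The Stanley--Reisner ideal of the dual subword complex\<close>

lemma mpoly_ring_simps [simp]:
  "mult (mpoly_ring n) = (*)" "one (mpoly_ring n) = 1"
  "zero (mpoly_ring n) = 0" "add (mpoly_ring n) = (+)"
  by (simp_all add: mpoly_ring_def)

lemma mpoly_carrier_iff: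
  "p \<in> carrier (mpoly_ring n) \<longleftrightarrow> (\<forall>m\<in>Poly_Mapping.keys p. Poly_Mapping.keys m \<subseteq> {..<n})"
  by (simp add: mpoly_ring_def)

lemma mpoly_mult_closed:
  assumes "p \<in> carrier (mpoly_ring n)" "q \<in> carrier (mpoly_ring n)"
  shows "p * q \<in> carrier (mpoly_ring n)"
  unfolding mpoly_carrier_iff
proof
  fix m assume "m \<in> Poly_Mapping.keys (p * q)"
  then obtain a b where "m = a + b" "a \<in> Poly_Mapping.keys p" "b \<in> Poly_Mapping.keys q"
    using keys_mult[of p q] by blast
  then show "Poly_Mapping.keys m \<subseteq> {..<n}"
    using assms Poly_Mapping.keys_add[of a b] by (fastforce simp: mpoly_carrier_iff)
qed

lemma mpoly_add_closed:
  assumes "p \<in> carrier (mpoly_ring n)" "q \<in> carrier (mpoly_ring n)"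
  shows "p + q \<in> carrier (mpoly_ring n)"
  using assms Poly_Mapping.keys_add[of p q] by (fastforce simp: mpoly_carrier_iff)

lemma mpoly_ring_cring: "cring (mpoly_ring n :: ((nat \<Rightarrow>\<^sub>0 nat) \<Rightarrow>\<^sub>0 'k::field) ring)"
proof (rule cringI)
  show "abelian_group (mpoly_ring n :: ((nat \<Rightarrow>\<^sub>0 nat) \<Rightarrow>\<^sub>0 'k::field) ring)"
  proof (rule abelian_groupI)
    fix p :: "(nat \<Rightarrow>\<^sub>0 nat) \<Rightarrow>\<^sub>0 'k"
    assume "p \<in> carrier (mpoly_ring n)"
    then have "- p \<in> carrier (mpoly_ring n)" by (simp add: mpoly_carrier_iff in_keys_iff)
    then show "\<exists>y\<in>carrier (mpoly_ring n). y \<oplus>\<^bsub>mpoly_ring n\<^esub> p = \<zero>\<^bsub>mpoly_ring n\<^esub>"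
      by (intro bexI[of _ "- p"]) simp_all
  qed (simp_all add: mpoly_add_closed, simp_all add: mpoly_carrier_iff add_ac)
  show "Group.comm_monoid (mpoly_ring n :: ((nat \<Rightarrow>\<^sub>0 nat) \<Rightarrow>\<^sub>0 'k::field) ring)"
    by (rule comm_monoidI) (simp_all add: mpoly_mult_closed, simp_all add: mpoly_carrier_iff mult_ac)
qed (simp add: distrib_right)

lemma xmonom_closed:
  "P \<subseteq> {..<n} \<Longrightarrow> (xmonom P :: (nat \<Rightarrow>\<^sub>0 nat) \<Rightarrow>\<^sub>0 'k::field) \<in> carrier (mpoly_ring n)"
proof (induction P rule: infinite_finite_induct)
  case (insert i P)
  have "(pvar i :: (nat \<Rightarrow>\<^sub>0 nat) \<Rightarrow>\<^sub>0 'k) \<in> carrier (mpoly_ring n)"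
    using insert.prems by (auto simp: pvar_def mpoly_carrier_iff)
  with insert show ?case by (simp add: xmonom_def mpoly_mult_closed)
qed (simp_all add: xmonom_def mpoly_carrier_iff)

theorem stanley_reisner_dual_subword_complex:
  "stanley_reisner_ideal (length Q) (alexander_dual (length Q) (subword_complex W S Q w)) =
   genideal (mpoly_ring (length Q)) {xmonom P :: (nat \<Rightarrow>\<^sub>0 nat) \<Rightarrow>\<^sub>0 'k::field | P. represents W S Q P w}"
    (is "?I = genideal ?R ?G")
proof -
  interpret R: cring ?R by (rule mpoly_ring_cring)
  have face: "F \<notin> alexander_dual (length Q) (subword_complex W S Q w)
      \<longleftrightarrow> subword_contains W S Q F w" if "F \<subseteq> {..<length Q}" for F
  proof -
    have "P = F" if "{..<length Q} - F = {..<length Q} - P" "subword_contains W S Q P w" for P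
      using that \<open>F \<subseteq> {..<length Q}\<close> unfolding subword_contains_def by blast
    then show ?thesis using that by (auto simp: alexander_dual_def subword_complex_def)
  qed
  let ?H = "{xmonom F :: (nat \<Rightarrow>\<^sub>0 nat) \<Rightarrow>\<^sub>0 'k | F. subword_contains W S Q F w}"
  have I: "?I = genideal ?R ?H"
    unfolding stanley_reisner_ideal_def using face
    by (intro arg_cong[where f = "genideal ?R"]) (auto simp: subword_contains_def)
  have carr: "?G \<subseteq> carrier ?R" "?H \<subseteq> carrier ?R"
    by (auto simp: represents_def subword_contains_def intro!: xmonom_closed)
  have id: "ideal (genideal ?R ?G) ?R" "ideal (genideal ?R ?H) ?R"
    using carr by (auto intro: R.genideal_ideal)
  have "?G \<subseteq> ?H" by (auto simp: represents_def subword_contains_def)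
  then have "?G \<subseteq> genideal ?R ?H" using R.genideal_self[OF carr(2)] by (rule subset_trans)
  then have "genideal ?R ?G \<subseteq> genideal ?R ?H" by (rule R.genideal_minimal[OF id(2)])
  moreover have "?H \<subseteq> genideal ?R ?G"
  proof
    fix h assume "h \<in> ?H"
    then obtain F P where h: "h = xmonom F" "F \<subseteq> {..<length Q}" "P \<subseteq> F" "represents W S Q P w"
      by (auto simp: subword_contains_def)
    then have "finite F" by (meson finite_lessThan finite_subset)
    then have "h = xmonom (F - P) * xmonom P"
      using h by (simp add: xmonom_def prod.subset_diff)
    moreover have "xmonom P \<in> genideal ?R ?G"
      by (rule subsetD[OF R.genideal_self[OF carr(1)]]) (use h in blast)
    moreover have "xmonom (F - P) \<in> carrier ?R" using h by (intro xmonom_closed) auto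
    ultimately show "h \<in> genideal ?R ?G"
      using ideal.I_l_closed[OF id(1)] by simp
  qed
  then have "genideal ?R ?H \<subseteq> genideal ?R ?G" by (rule R.genideal_minimal[OF id(1)])
  ultimately show ?thesis using I by simp
qed

text \<open>The natural number subtraction \<open>length Q - coxeter_length W S w\<close> is not truncated
  when \<open>Q\<close> contains \<open>w\<close>.\<close>

lemma coxeter_length_le:
  assumes "subword_contains W S Q P w"
  shows "coxeter_length W S w \<le> length Q"
proof -
  obtain P' where "length (nths Q P') = coxeter_length W S w"
    using assms by (auto simp: subword_contains_def represents_def)
  moreover have "length (nths Q P') \<le> length Q"
    using card_mono[of "{..<length Q}" "{i. i < length Q \<and> i \<in> P'}"]
    by (auto simp: length_nths)
  ultimately show ?thesis by simp
qed

end

theory Submission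
  imports Defs "HOL-Library.Function_Algebras" "HOL-Library.Sublist"
begin

text \<open>Let \<open>Q\<close> end in the letter \<open>s\<close>, say \<open>Q = Q' s\<close> with last variable \<open>x\<close>, and write \<open>I(Q, w)\<close> for
  the ideal generated by the monomials of the subwords of \<open>Q\<close> representing \<open>w\<close>.  If \<open>w s\<close> is not
  shorter than \<open>w\<close>, no such subword uses the last letter and \<open>I(Q, w) = I(Q', w)\<close>.  Otherwise
  \<open>I(Q, w) = x J + K\<close> with \<open>J = I(Q', w s)\<close> and \<open>K = I(Q', w)\<close>.  The variable \<open>x\<close> does not occur in the
  generators of \<open>K\<close>, so \<open>K : x = K\<close>; and \<open>K \<subseteq> J\<close>, because by the exchange condition every reduced
  word for \<open>w\<close> contains one for \<open>w s\<close>.  Hence there is an exact sequence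
  \<open>0 \<rightarrow> K \<rightarrow> J \<oplus> K \<rightarrow> I(Q, w) \<rightarrow> 0\<close> with maps \<open>k \<mapsto> (k, - x k)\<close> and \<open>(j, k) \<mapsto> x j + k\<close>, and the
  projective dimension of \<open>I(Q, w)\<close> is at most the maximum of those of \<open>J\<close> and of \<open>K\<close> plus one.
  By induction on the word the former is at most \<open>(n - 1) - (\<ell>(w) - 1)\<close> and the latter at most
  \<open>(n - 1) - \<ell>(w)\<close>, where \<open>n\<close> is the size of \<open>Q\<close>, which gives the bound \<open>n - \<ell>(w)\<close>.

  On the homological side, all modules are submodules of the module of sequences over a ring, and a
  bound on the projective dimension is recorded by taking syzygies repeatedly.  The
  horseshoe lemma \<open>resolved_by_extension\<close> yields the bound for the last term of a short exact
  sequence (\<open>resolved_by_quotient\<close>), hence for \<open>x J + K\<close> (\<open>resolved_by_ideal_cone\<close>).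

  The exchange condition is deduced from the presentation of the Coxeter group.  The number of times
  that a word passes through a given reflection is unchanged modulo two by the defining relations, so
  it is an invariant of the group element (\<open>odd_reflection_cong\<close>), and a letter at which a word passes
  through the reflection \<open>t\<close> can be deleted at the cost of a factor \<open>t\<close>
  (\<open>odd_reflection_deletion\<close>).\<close>

section \<open>Finite free resolutions of submodules of a sequence module\<close>

definition vec_scale :: "'a::times \<Rightarrow> (nat \<Rightarrow> 'a) \<Rightarrow> nat \<Rightarrow> 'a" where
  "vec_scale a f = (\<lambda>k. a * f k)"

definition lincomb :: "nat \<Rightarrow> (nat \<Rightarrow> nat \<Rightarrow> 'a::comm_ring_1) \<Rightarrow> (nat \<Rightarrow> 'a) \<Rightarrow> nat \<Rightarrow> 'a" where
  "lincomb b v f = (\<lambda>k. \<Sum>i<b. f i * v i k)"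

lemma constant_zero [simp]: "(\<lambda>_. 0) = (0 :: nat \<Rightarrow> 'a::zero)"
  by (simp add: zero_fun_def)

lemma vec_scale_apply [simp]: "vec_scale a f k = a * f k"
  by (simp add: vec_scale_def)

lemma lincomb_0 [simp]: "lincomb 0 v f = 0"
  by (simp add: lincomb_def)

lemma lincomb_Suc: "lincomb (Suc b) v f = lincomb b v f + vec_scale (f b) (v b)"
  by (simp add: lincomb_def fun_eq_iff)

lemma lincomb_add: "lincomb b v (f + g) = lincomb b v f + lincomb b v g"
  by (simp add: lincomb_def fun_eq_iff distrib_right sum.distrib)

lemma lincomb_scale: "lincomb b v (vec_scale a f) = vec_scale a (lincomb b v f)"
  by (simp add: lincomb_def fun_eq_iff sum_distrib_left mult_ac)

lemma lincomb_zero [simp]: "lincomb b v 0 = 0"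
  by (simp add: lincomb_def fun_eq_iff)

lemma lincomb_cong:
  "(\<And>i. i < b \<Longrightarrow> f i = g i) \<Longrightarrow> (\<And>i. i < b \<Longrightarrow> v i = w i) \<Longrightarrow> lincomb b v f = lincomb b w g"
  by (simp add: lincomb_def)

lemma lincomb_append:
  "lincomb (a + c) v f = lincomb a v f + lincomb c (\<lambda>j. v (a + j)) (\<lambda>j. f (a + j))"
  by (induction c) (simp_all add: lincomb_Suc add.assoc)

text \<open>The scalars form a subring of the ambient ring, since polynomials in \<open>n\<close> variables are
  embedded in those in countably many variables.\<close>

locale coefficient_ring =
  fixes R :: "'a::comm_ring_1 set"
  assumes zero_closed [simp, intro]: "0 \<in> R"
    and one_closed [simp, intro]: "1 \<in> R"
    and add_closed [intro]: "a \<in> R \<Longrightarrow> b \<in> R \<Longrightarrow> a + b \<in> R"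
    and uminus_closed [intro]: "a \<in> R \<Longrightarrow> - a \<in> R"
    and mult_closed [intro]: "a \<in> R \<Longrightarrow> b \<in> R \<Longrightarrow> a * b \<in> R"
begin

definition submod :: "(nat \<Rightarrow> 'a) set \<Rightarrow> bool" where
  "submod M \<longleftrightarrow> 0 \<in> M \<and> (\<forall>x\<in>M. \<forall>y\<in>M. x + y \<in> M) \<and> (\<forall>a\<in>R. \<forall>x\<in>M. vec_scale a x \<in> M)"

definition linear_on :: "(nat \<Rightarrow> 'a) set \<Rightarrow> ((nat \<Rightarrow> 'a) \<Rightarrow> nat \<Rightarrow> 'a) \<Rightarrow> bool" where
  "linear_on M p \<longleftrightarrow> (\<forall>x\<in>M. \<forall>y\<in>M. p (x + y) = p x + p y) \<and>
     (\<forall>a\<in>R. \<forall>x\<in>M. p (vec_scale a x) = vec_scale a (p x))"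

definition free :: "nat \<Rightarrow> (nat \<Rightarrow> 'a) set" where
  "free b = {f. (\<forall>i. f i \<in> R) \<and> (\<forall>i\<ge>b. f i = 0)}"

definition relations :: "nat \<Rightarrow> (nat \<Rightarrow> nat \<Rightarrow> 'a) \<Rightarrow> (nat \<Rightarrow> 'a) set" where
  "relations b v = {f \<in> free b. lincomb b v f = 0}"

text \<open>The recursion follows the syzygies.  Starting it at the zero module, i.e. counting the
  nonzero terms of a resolution rather than its length, makes the zero module the only base case;
  finite free resolutions of length \<open>d\<close> belong to the index \<open>Suc d\<close>.\<close>

primrec resolved_by :: "nat \<Rightarrow> (nat \<Rightarrow> 'a) set \<Rightarrow> bool" where
  "resolved_by 0 M \<longleftrightarrow> M = {0}"
| "resolved_by (Suc d) M \<longleftrightarrow>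
     (\<exists>b v. (\<forall>i<b. v i \<in> M) \<and> lincomb b v ` free b = M \<and> resolved_by d (relations b v))"

lemma submodD:
  assumes "submod M"
  shows "0 \<in> M" "x \<in> M \<Longrightarrow> y \<in> M \<Longrightarrow> x + y \<in> M" "a \<in> R \<Longrightarrow> x \<in> M \<Longrightarrow> vec_scale a x \<in> M"
  using assms by (auto simp: submod_def)

lemma submod_diff:
  assumes "submod M" "x \<in> M" "y \<in> M"
  shows "x - y \<in> M"
proof -
  have "x - y = x + vec_scale (- 1) y" by (simp add: fun_eq_iff)
  moreover have "x + vec_scale (- 1) y \<in> M"
    using assms by (intro submodD[OF assms(1)] uminus_closed one_closed)
  ultimately show ?thesis by (simp only:)
qed

lemma linear_onD:
  assumes "linear_on M p"
  shows "x \<in> M \<Longrightarrow> y \<in> M \<Longrightarrow> p (x + y) = p x + p y"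
    "a \<in> R \<Longrightarrow> x \<in> M \<Longrightarrow> p (vec_scale a x) = vec_scale a (p x)"
  using assms by (auto simp: linear_on_def)

lemma linear_on_zero:
  assumes "linear_on M p" "submod M"
  shows "p 0 = 0"
proof -
  have "vec_scale 0 0 = (0 :: nat \<Rightarrow> 'a)" by (simp add: fun_eq_iff)
  then have "p 0 = vec_scale 0 (p 0)" using linear_onD(2)[OF assms(1), of 0 0] submodD(1)[OF assms(2)] by simp
  then show ?thesis by (simp add: fun_eq_iff)
qed

lemma linear_on_diff:
  assumes "linear_on M p" "submod M" "x \<in> M" "y \<in> M"
  shows "p (x - y) = p x - p y"
proof -
  have "p x = p ((x - y) + y)" by simp
  also have "\<dots> = p (x - y) + p y"
    by (rule linear_onD(1)[OF assms(1) submod_diff[OF assms(2-4)] assms(4)])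
  finally show ?thesis by simp
qed

lemma lincomb_closed:
  assumes "submod M" "\<And>i. i < b \<Longrightarrow> v i \<in> M" "\<And>i. i < b \<Longrightarrow> f i \<in> R"
  shows "lincomb b v f \<in> M"
  using assms(2,3) by (induction b) (simp_all add: lincomb_Suc submodD[OF assms(1)])

lemma linear_on_lincomb:
  assumes "linear_on M p" "submod M" "\<And>i. i < b \<Longrightarrow> v i \<in> M" "\<And>i. i < b \<Longrightarrow> f i \<in> R"
  shows "p (lincomb b v f) = lincomb b (\<lambda>i. p (v i)) f"
  using assms(3,4)
proof (induction b)
  case 0
  then show ?case using linear_on_zero[OF assms(1,2)] by simp
next
  case (Suc b)
  then have "lincomb b v f \<in> M" "v b \<in> M" "f b \<in> R"
    by (auto intro: lincomb_closed[OF assms(2)])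
  with Suc show ?case
    by (simp add: lincomb_Suc linear_onD[OF assms(1)] submodD[OF assms(2)]
      del: plus_fun_apply vec_scale_apply)
qed

lemma freeD: "f \<in> free b \<Longrightarrow> f i \<in> R"
  by (simp add: free_def)

lemma submod_free: "submod (free b)"
  by (auto simp: submod_def free_def add_closed mult_closed)

lemma submod_ker:
  assumes "submod M" "linear_on M p"
  shows "submod {x \<in> M. p x = 0}"
  using linear_on_zero[OF assms(2,1)] assms
  by (auto simp: submod_def linear_on_def fun_eq_iff)

lemma linear_on_lincomb_free: "linear_on M (lincomb b v)"
  by (simp add: linear_on_def lincomb_add lincomb_scale)

lemma submod_relations: "submod (relations b v)"
  unfolding relations_def by (intro submod_ker submod_free linear_on_lincomb_free)

lemma lincomb_restrict_free:
  assumes "\<And>i. f i \<in> R"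
  obtains g where "g \<in> free b" "lincomb b v f = lincomb b v g"
proof
  show "(\<lambda>i. if i < b then f i else 0) \<in> free b"
    using assms by (simp add: free_def)
  show "lincomb b v f = lincomb b v (\<lambda>i. if i < b then f i else 0)"
    by (rule lincomb_cong) simp_all
qed

lemma resolved_by_zero: "resolved_by d {0}"
proof (induction d)
  case (Suc d)
  have "free 0 = {0}" by (auto simp: free_def fun_eq_iff)
  then have "relations 0 (\<lambda>_. 0) = {0}" "lincomb 0 (\<lambda>_. 0) ` free 0 = {0}"
    by (auto simp: relations_def)
  with Suc show ?case unfolding resolved_by.simps
    by (intro exI[of _ 0] exI[of _ "\<lambda>_. 0"] conjI) (simp_all only: less_nat_zero_code, auto)
qed simp

lemma resolved_by_Suc: "resolved_by d M \<Longrightarrow> resolved_by (Suc d) M"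
proof (induction d arbitrary: M)
  case 0
  then show ?case using resolved_by_zero by (metis resolved_by.simps(1))
next
  case (Suc d)
  from Suc.prems obtain b v where "\<forall>i<b. v i \<in> M" "lincomb b v ` free b = M"
    "resolved_by d (relations b v)" by auto
  with Suc.IH have "\<forall>i<b. v i \<in> M" "lincomb b v ` free b = M"
    "resolved_by (Suc d) (relations b v)" by blast+
  then show ?case by (subst resolved_by.simps(2)) blast
qed

lemma resolved_by_mono: "d \<le> e \<Longrightarrow> resolved_by d M \<Longrightarrow> resolved_by e M"
  by (induction e rule: dec_induct) (blast intro: resolved_by_Suc)+

text \<open>The horseshoe lemma for \<open>0 \<rightarrow> ker p \<rightarrow> M \<rightarrow> p ` M \<rightarrow> 0\<close>: generators of the kernel together with
  lifts of generators of the image generate \<open>M\<close>, and dropping the first coordinates of a relation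
  gives a sequence of the same shape between the modules of relations.  Taking a bijective \<open>p\<close>
  shows that \<^const>\<open>resolved_by\<close> is invariant under isomorphism.\<close>

lemma resolved_by_extension:
  assumes "submod M" "linear_on M p"
    and "resolved_by d {x \<in> M. p x = 0}" "resolved_by d (p ` M)"
  shows "resolved_by d M"
  using assms
proof (induction d arbitrary: M p)
  case 0
  then show ?case using submodD(1)[OF "0.prems"(1)] by fastforce
next
  case (Suc d)
  note M = Suc.prems(1) and p = Suc.prems(2)
  define A where "A = {x \<in> M. p x = 0}"
  from Suc.prems(3) obtain a u where u: "\<And>i. i < a \<Longrightarrow> u i \<in> A" and uA: "lincomb a u ` free a = A"
    and ru: "resolved_by d (relations a u)" by (auto simp: A_def)
  from Suc.prems(4) obtain c v where v: "\<And>i. i < c \<Longrightarrow> v i \<in> p ` M"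
    and vC: "lincomb c v ` free c = p ` M" and rv: "resolved_by d (relations c v)" by auto
  from v have "\<forall>i. \<exists>x. i < c \<longrightarrow> x \<in> M \<and> p x = v i" by fastforce
  then obtain w where w: "\<And>i. i < c \<Longrightarrow> w i \<in> M" "\<And>i. i < c \<Longrightarrow> p (w i) = v i" by metis
  define z where "z i = (if i < a then u i else w (i - a))" for i
  have AM: "A \<subseteq> M" by (auto simp: A_def)
  have z: "z i \<in> M" if "i < a + c" for i using that u w AM by (auto simp: z_def)
  have split: "lincomb (a + c) z h = lincomb a u h + lincomb c w (\<lambda>j. h (a + j))" for h
    by (subst lincomb_append)
      (intro arg_cong2[where f = "(+)"] lincomb_cong; simp add: z_def)
  have p_w: "p (lincomb c w g) = lincomb c v g" if "\<And>i. g i \<in> R" for g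
    using linear_on_lincomb[OF p M, of c w g] w that by (simp cong: lincomb_cong)
  have u_A: "lincomb a u h \<in> A" if h: "\<And>i. h i \<in> R" for h
    using lincomb_restrict_free[of h a u, OF h] uA by auto
  have w_M: "lincomb c w g \<in> M" if "\<And>i. g i \<in> R" for g
    using that w by (intro lincomb_closed[OF M])
  have lift: "\<exists>h \<in> free (a + c). (\<forall>j. h (a + j) = g j) \<and> lincomb (a + c) z h = x"
    if g: "g \<in> free c" "lincomb c v g = p x" "x \<in> M" for g x
  proof -
    have "x - lincomb c w g \<in> A"
      using g w_M[of g] freeD p_w[of g]
      by (auto simp: A_def linear_on_diff[OF p M] intro!: submod_diff[OF M])
    then obtain f where f: "f \<in> free a" "lincomb a u f = x - lincomb c w g"
      by (auto simp flip: uA)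
    define h where "h i = (if i < a then f i else g (i - a))" for i
    have "h \<in> free (a + c)" using f g by (auto simp: free_def h_def)
    moreover have "lincomb a u h = lincomb a u f" by (rule lincomb_cong) (simp_all add: h_def)
    then have "lincomb (a + c) z h = x" by (simp add: split f) (simp add: h_def)
    ultimately show ?thesis by (intro bexI[of _ h]) (simp_all add: h_def)
  qed
  have "lincomb (a + c) z ` free (a + c) = M"
  proof
    show "lincomb (a + c) z ` free (a + c) \<subseteq> M"
      using z by (auto intro!: lincomb_closed[OF M] dest: freeD)
    show "M \<subseteq> lincomb (a + c) z ` free (a + c)"
    proof
      fix x assume x: "x \<in> M"
      then have "p x \<in> lincomb c v ` free c" using vC by blast
      then obtain g where "g \<in> free c" "lincomb c v g = p x" by (metis imageE)
      with lift[of g x] x show "x \<in> lincomb (a + c) z ` free (a + c)" by blast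
    qed
  qed
  moreover have "resolved_by d (relations (a + c) z)"
  proof (rule Suc.IH)
    let ?q = "\<lambda>h j. h (a + j)"
    show "submod (relations (a + c) z)" by (rule submod_relations)
    show "linear_on (relations (a + c) z) ?q"
      by (auto simp: linear_on_def fun_eq_iff)
    have "{h \<in> relations (a + c) z. ?q h = 0} = relations a u"
    proof (intro subset_antisym subsetI)
      fix h assume h: "h \<in> {h \<in> relations (a + c) z. ?q h = 0}"
      have "h i = 0" if "i \<ge> a" for i
        using h fun_cong[of "?q h" 0 "i - a"] that by simp
      with h show "h \<in> relations a u" by (simp add: relations_def split free_def)
    next
      fix h assume "h \<in> relations a u"
      then show "h \<in> {h \<in> relations (a + c) z. ?q h = 0}"
        by (auto simp: relations_def split free_def zero_fun_def[symmetric])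
    qed
    with ru show "resolved_by d {h \<in> relations (a + c) z. ?q h = 0}" by simp
    have "?q ` relations (a + c) z = relations c v"
    proof (intro subset_antisym subsetI)
      fix g assume "g \<in> ?q ` relations (a + c) z"
      then obtain h where h: "h \<in> relations (a + c) z" "g = ?q h" by blast
      then have hR: "\<And>i. h i \<in> R" and g: "g \<in> free c" by (auto simp: relations_def free_def)
      have "0 = p (lincomb a u h + lincomb c w g)"
        using h linear_on_zero[OF p M] by (simp add: relations_def split)
      also have "\<dots> = p (lincomb a u h) + p (lincomb c w g)"
        using u_A[OF hR] AM w_M[of g] freeD[OF g] by (intro linear_onD[OF p]) auto
      also have "\<dots> = lincomb c v g"
        using u_A[OF hR] p_w[of g] freeD[OF g] by (simp add: A_def)
      finally show "g \<in> relations c v" using g by (simp add: relations_def)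
    next
      fix g assume "g \<in> relations c v"
      then have "g \<in> free c" "lincomb c v g = p 0"
        using linear_on_zero[OF p M] by (auto simp: relations_def)
      from lift[OF this submodD(1)[OF M]] obtain h
        where h: "h \<in> free (a + c)" "\<And>j. h (a + j) = g j" "lincomb (a + c) z h = 0" by blast
      then show "g \<in> ?q ` relations (a + c) z"
        by (intro image_eqI[of _ _ h]) (auto simp: relations_def)
    qed
    with rv show "resolved_by d (?q ` relations (a + c) z)" by simp
  qed
  ultimately show ?case using z by auto
qed

text \<open>Lift the generators of \<open>M\<close> to a free module \<open>F\<close>.  The relations between their images in
  \<open>p ` M\<close> are the vectors of \<open>F\<close> that land in the kernel of \<open>p\<close>, hence an extension of that kernel by
  the relations between the generators of \<open>M\<close>.  Only the first presentation is touched, where a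
  mapping cone would lift a map to whole resolutions.\<close>

lemma resolved_by_quotient:
  assumes M: "submod M" and p: "linear_on M p"
    and ker: "resolved_by d {x \<in> M. p x = 0}" and "resolved_by (Suc d) M"
  shows "resolved_by (Suc d) (p ` M)"
proof -
  from assms(4) obtain b v where v: "\<And>i. i < b \<Longrightarrow> v i \<in> M" and vM: "lincomb b v ` free b = M"
    and rv: "resolved_by d (relations b v)" by auto
  let ?u = "\<lambda>i. p (v i)"
  have pv: "p (lincomb b v f) = lincomb b ?u f" if "f \<in> free b" for f
    using v freeD[OF that] by (intro linear_on_lincomb[OF p M])
  have "lincomb b ?u ` free b = p ` M"
    using pv by (simp add: vM[symmetric] image_image)
  moreover have "resolved_by d (relations b ?u)"
  proof (rule resolved_by_extension)
    show "submod (relations b ?u)" by (rule submod_relations)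
    show "linear_on (relations b ?u) (lincomb b v)" by (rule linear_on_lincomb_free)
    have "{f \<in> relations b ?u. lincomb b v f = 0} = relations b v"
      using pv linear_on_zero[OF p M] by (force simp: relations_def)
    with rv show "resolved_by d {f \<in> relations b ?u. lincomb b v f = 0}" by simp
    have "lincomb b v ` relations b ?u = {x \<in> M. p x = 0}"
      using pv by (force simp: relations_def simp flip: vM)
    with ker show "resolved_by d (lincomb b v ` relations b ?u)" by simp
  qed
  ultimately show ?thesis using v unfolding resolved_by.simps
    by (intro exI[of _ b] exI[of _ ?u] conjI) blast+
qed

definition ideal_in :: "'a set \<Rightarrow> bool" where
  "ideal_in I \<longleftrightarrow> I \<subseteq> R \<and> 0 \<in> I \<and> (\<forall>x\<in>I. \<forall>y\<in>I. x + y \<in> I) \<and> (\<forall>a\<in>R. \<forall>x\<in>I. a * x \<in> I)"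

text \<open>An ideal becomes a submodule of the sequences when its elements are placed in coordinate
  \<open>0\<close>.\<close>

definition embed :: "'a \<Rightarrow> nat \<Rightarrow> 'a" where
  "embed a = (\<lambda>k. if k = 0 then a else 0)"

lemma embed_simps [simp]: "embed a 0 = a" "k > 0 \<Longrightarrow> embed a k = 0"
  by (simp_all add: embed_def)

lemma embed_zero [simp]: "embed 0 = 0"
  by (simp add: embed_def fun_eq_iff)

lemma embed_eq_zero_iff [simp]: "embed a = 0 \<longleftrightarrow> a = 0"
  by (auto simp: embed_def fun_eq_iff)

lemma resolved_by_whole_ring: "resolved_by (Suc 0) (embed ` R)"
proof -
  have lc: "lincomb 1 (\<lambda>_. embed 1) f = f" if "f \<in> free 1" for f
    using that by (auto simp: lincomb_def free_def fun_eq_iff embed_def)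
  have "free 1 = embed ` R"
  proof
    show "free 1 \<subseteq> embed ` R"
    proof
      fix f assume "f \<in> free 1"
      then have "f = embed (f 0)" "f 0 \<in> R" by (auto simp: free_def embed_def fun_eq_iff)
      then show "f \<in> embed ` R" by blast
    qed
  qed (auto simp: free_def embed_def)
  moreover have "lincomb 1 (\<lambda>_. embed 1) ` free 1 = free 1" using lc by force
  moreover have "relations 1 (\<lambda>_. embed 1) = {0}"
    using lc submodD(1)[OF submod_free[of 1]] by (fastforce simp: relations_def)
  ultimately show ?thesis by (auto intro!: exI[of _ 1] exI[of _ "\<lambda>_. embed 1"])
qed

text \<open>The ideal \<open>x J + K\<close> is the image of \<open>J \<oplus> K\<close> under \<open>(j, k) \<mapsto> x j + k\<close>.  If \<open>K : x = K\<close> and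
  \<open>K \<subseteq> J\<close>, then the kernel consists of the pairs \<open>(j, - x j)\<close> with \<open>j \<in> K\<close> and is thus a copy
  of \<open>K\<close>.\<close>

lemma resolved_by_ideal_cone:
  assumes J: "ideal_in J" and K: "ideal_in K" and KJ: "K \<subseteq> J" and x: "x \<in> R"
    and colon: "\<And>j. j \<in> J \<Longrightarrow> x * j \<in> K \<Longrightarrow> j \<in> K"
    and rJ: "resolved_by (Suc d) (embed ` J)" and rK: "resolved_by d (embed ` K)"
  shows "resolved_by (Suc d) (embed ` {x * j + k | j k. j \<in> J \<and> k \<in> K})"
proof -
  define M where "M = {f :: nat \<Rightarrow> 'a. f 0 \<in> J \<and> f 1 \<in> K \<and> (\<forall>i\<ge>2. f i = 0)}"
  define p where "p f = embed (x * f 0 + f 1)" for f :: "nat \<Rightarrow> 'a"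
  have pairI: "embed j + (\<lambda>i. if i = 1 then k else 0) \<in> M" if "j \<in> J" "k \<in> K" for j k
    using that by (simp add: M_def)
  have M: "submod M" using J K by (auto simp: submod_def M_def ideal_in_def)
  have p: "linear_on M p"
    by (auto simp: linear_on_def p_def embed_def fun_eq_iff algebra_simps)
  have one_minus: "- y \<in> K" if "y \<in> K" for y
  proof -
    have "(- 1) * y \<in> K" using K that uminus_closed[of 1] unfolding ideal_in_def by blast
    then show ?thesis by simp
  qed
  have "resolved_by d {f \<in> M. p f = 0}"
    \<comment> \<open>Reading off the first component \<open>j\<close> is an isomorphism onto \<open>K\<close>.\<close>
  proof (rule resolved_by_extension)
    let ?q = "\<lambda>f :: nat \<Rightarrow> 'a. embed (f 0)"
    show "submod {f \<in> M. p f = 0}" by (rule submod_ker[OF M p])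
    show "linear_on {f \<in> M. p f = 0} ?q"
      by (auto simp: linear_on_def embed_def fun_eq_iff)
    have "f = 0" if "f \<in> M" "p f = 0" "?q f = 0" for f
    proof
      fix i :: nat
      have "f 0 = 0" using that(3) by (simp only: embed_eq_zero_iff)
      moreover from this have "f 1 = 0"
        using that(2) unfolding p_def embed_eq_zero_iff by simp
      moreover have "\<forall>i\<ge>2. f i = 0" using that(1) by (simp add: M_def)
      moreover have "i = 0 \<or> i = 1 \<or> i \<ge> 2" by arith
      ultimately show "f i = 0 i" by auto
    qed
    then have "{f \<in> {f \<in> M. p f = 0}. ?q f = 0} = {0}"
      using submodD(1)[OF submod_ker[OF M p]] by auto
    then show "resolved_by d {f \<in> {f \<in> M. p f = 0}. ?q f = 0}"
      using resolved_by_zero by simp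
    have "?q ` {f \<in> M. p f = 0} = embed ` K"
    proof (intro subset_antisym subsetI)
      fix g assume "g \<in> ?q ` {f \<in> M. p f = 0}"
      then obtain f where f: "f \<in> M" "p f = 0" "g = embed (f 0)" by blast
      then have "x * f 0 = - f 1"
        unfolding p_def embed_eq_zero_iff by (simp only: eq_neg_iff_add_eq_0)
      then have "x * f 0 \<in> K" using f one_minus by (simp add: M_def)
      then show "g \<in> embed ` K" using f colon by (auto simp: M_def)
    next
      fix g assume "g \<in> embed ` K"
      then obtain k where k: "k \<in> K" "g = embed k" by blast
      let ?f = "embed k + (\<lambda>i. if i = 1 then - (x * k) else 0)"
      have "x * k \<in> K" using K k x by (auto simp: ideal_in_def)
      then have "?f \<in> M" using k KJ one_minus by (intro pairI) auto
      moreover have "p ?f = 0" by (simp add: p_def)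
      ultimately show "g \<in> ?q ` {f \<in> M. p f = 0}" using k by (intro image_eqI[of _ _ ?f]) auto
    qed
    with rK show "resolved_by d (?q ` {f \<in> M. p f = 0})" by simp
  qed
  \<comment> \<open>The direct sum is an extension of \<open>K\<close> by \<open>J\<close>.\<close>
  moreover have "resolved_by (Suc d) M"
  proof (rule resolved_by_extension[OF M])
    let ?q = "\<lambda>f :: nat \<Rightarrow> 'a. embed (f 1)"
    show "linear_on M ?q" by (auto simp: linear_on_def embed_def fun_eq_iff)
    have "{f \<in> M. ?q f = 0} = embed ` J"
    proof (intro subset_antisym subsetI)
      fix f assume f: "f \<in> {f \<in> M. ?q f = 0}"
      have "f i = embed (f 0) i" for i
      proof -
        have "f 1 = 0" "\<forall>i\<ge>2. f i = 0" using f by (auto simp: M_def)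
        moreover have "i = 0 \<or> i = 1 \<or> i \<ge> 2" by arith
        ultimately show ?thesis by auto
      qed
      then have "f = embed (f 0)" by (rule ext)
      then show "f \<in> embed ` J" using f by (auto simp: M_def intro!: image_eqI[of _ _ "f 0"])
    qed (use K in \<open>auto simp: M_def ideal_in_def\<close>)
    with rJ show "resolved_by (Suc d) {f \<in> M. ?q f = 0}" by simp
    have "?q ` M = embed ` K"
    proof (intro subset_antisym subsetI)
      fix g assume "g \<in> embed ` K"
      then obtain k where k: "k \<in> K" "g = embed k" by blast
      with J show "g \<in> ?q ` M"
        by (intro image_eqI[OF _ pairI[of 0 k]]) (auto simp: ideal_in_def)
    qed (auto simp: M_def)
    with resolved_by_Suc[OF rK] show "resolved_by (Suc d) (?q ` M)" by simp
  qed
  ultimately have "resolved_by (Suc d) (p ` M)" by (intro resolved_by_quotient[OF M p])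
  moreover have "p ` M = embed ` {x * j + k | j k. j \<in> J \<and> k \<in> K}"
  proof (intro subset_antisym subsetI)
    fix g assume "g \<in> embed ` {x * j + k | j k. j \<in> J \<and> k \<in> K}"
    then obtain j k where jk: "j \<in> J" "k \<in> K" "g = embed (x * j + k)" by blast
    then show "g \<in> p ` M" by (intro image_eqI[OF _ pairI[OF jk(1,2)]]) (simp add: p_def)
  qed (auto simp: M_def p_def)
  ultimately show ?thesis by simp
qed

lemma resolved_by_imp_complex:
  assumes "resolved_by d M"
  obtains b :: "nat \<Rightarrow> nat" and v :: "nat \<Rightarrow> nat \<Rightarrow> nat \<Rightarrow> 'a"
  where "\<And>i. i \<ge> d \<Longrightarrow> b i = 0" "lincomb (b 0) (v 0) ` free (b 0) = M"
    "\<And>i. lincomb (b (Suc i)) (v (Suc i)) ` free (b (Suc i)) = relations (b i) (v i)"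
proof -
  have "\<exists>b v. (\<forall>i\<ge>d. b i = 0) \<and> lincomb (b 0) (v 0) ` free (b 0) = M \<and>
    (\<forall>i. lincomb (b (Suc i)) (v (Suc i)) ` free (b (Suc i)) = relations (b i) (v i))"
    using assms
  proof (induction d arbitrary: M)
    case 0
    have "free 0 = {0}" by (auto simp: free_def fun_eq_iff)
    with 0 show ?case
      by (intro exI[of _ "\<lambda>_. 0"] exI[of _ "\<lambda>_ _. 0"]) (auto simp: relations_def)
  next
    case (Suc d)
    then obtain b0 v0 where 0: "lincomb b0 v0 ` free b0 = M" "resolved_by d (relations b0 v0)"
      by auto
    from Suc.IH[OF 0(2)] obtain b v where bv: "\<forall>i\<ge>d. b i = 0"
      "lincomb (b 0) (v 0) ` free (b 0) = relations b0 v0"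
      "\<And>i. lincomb (b (Suc i)) (v (Suc i)) ` free (b (Suc i)) = relations (b i) (v i)"
      by blast
    show ?case
    proof (intro exI conjI allI impI)
      fix i show "Suc d \<le> i \<Longrightarrow> case_nat b0 b i = 0" using bv(1) by (cases i) auto
      show "lincomb (case_nat b0 b (Suc i)) (case_nat v0 v (Suc i)) ` free (case_nat b0 b (Suc i))
          = relations (case_nat b0 b i) (case_nat v0 v i)"
        using bv(2,3) by (cases i) auto
    qed (simp add: 0)
  qed
  then show thesis using that by blast
qed

end

section \<open>The exchange condition\<close>

lemma subseq_nths_obtain:
  assumes "subseq u (nths Q P)"
  obtains P' where "P' \<subseteq> P" "u = nths Q P'"
proof -
  obtain N where "u = nths (nths Q P) N" using assms by (auto simp: subseq_conv_nths)
  then show thesis by (intro that[of "{i \<in> P. \<exists>j\<in>N. card {i' \<in> P. i' < i} = j}"]) (auto simp: nths_nths)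
qed

locale coxeter_group =
  fixes W :: "('w, 'b) monoid_scheme" (structure) and S :: "'w set"
  assumes system: "coxeter_system W S"
begin

sublocale group W
  using system by (simp add: coxeter_system_def)

abbreviation wprod :: "'w list \<Rightarrow> 'w" where
  "wprod \<equiv> word_prod W"

abbreviation len :: "'w \<Rightarrow> nat" where
  "len \<equiv> coxeter_length W S"

lemma generators_closed: "S \<subseteq> carrier W"
  using system by (simp add: coxeter_system_def)

lemma generator_closed [simp]: "s \<in> S \<Longrightarrow> s \<in> carrier W"
  using generators_closed by blast

lemma wprod_simps [simp]: "wprod [] = \<one>" "wprod (s # u) = s \<otimes> wprod u"
  by (simp_all add: word_prod_def)

lemma wprod_closed [simp]: "set u \<subseteq> S \<Longrightarrow> wprod u \<in> carrier W"
  by (induction u) auto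

lemma wprod_append [simp]:
  "set u \<subseteq> S \<Longrightarrow> set v \<subseteq> S \<Longrightarrow> wprod (u @ v) = wprod u \<otimes> wprod v"
  by (induction u) (auto simp: m_assoc)

lemma presentation:
  obtains m where "coxeter_matrix_on S m"
    "\<And>u v. u \<in> lists (S \<times> UNIV) \<Longrightarrow> v \<in> lists (S \<times> UNIV) \<Longrightarrow>
       wprod (map (letter_value W) u) = wprod (map (letter_value W) v) \<longleftrightarrow> presentation_eq S m u v"
  using system unfolding coxeter_system_def by blast

lemma generator_square [simp]:
  assumes "s \<in> S"
  shows "s \<otimes> s = \<one>"
proof -
  obtain m where m: "coxeter_matrix_on S m"
    "\<And>u v. u \<in> lists (S \<times> UNIV) \<Longrightarrow> v \<in> lists (S \<times> UNIV) \<Longrightarrow>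
       wprod (map (letter_value W) u) = wprod (map (letter_value W) v) \<longleftrightarrow> presentation_eq S m u v"
    by (rule presentation) blast
  have "m s s = enat 1" using m(1) assms by (simp add: coxeter_matrix_on_def one_enat_def)
  then have "presentation_eq S m [(s, True), (s, True)] []"
    using presentation_eq.relation[of "[]" S "[]" s s m 1] assms by simp
  then show ?thesis using m(2)[of "[(s, True), (s, True)]" "[]"] assms
    by (simp add: letter_value_def)
qed

lemma generator_inv [simp]: "s \<in> S \<Longrightarrow> inv s = s"
  by (intro inv_equality) simp_all

lemma wprod_letter_values:
  "u \<in> lists (S \<times> UNIV) \<Longrightarrow> wprod (map (letter_value W) u) = wprod (map fst u)"
  by (induction u rule: lists.induct) (auto simp: letter_value_def)

lemma map_fst_lists: "u \<in> lists (S \<times> UNIV) \<Longrightarrow> set (map fst u) \<subseteq> S"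
  by auto

lemma reduced_word_exists:
  assumes "w \<in> carrier W"
  obtains u where "set u \<subseteq> S" "wprod u = w" "length u = len w"
proof -
  obtain u where u: "u \<in> lists (S \<times> UNIV)" "wprod (map (letter_value W) u) = w"
    using system assms unfolding coxeter_system_def by blast
  then have "\<exists>ws\<in>lists S. length ws = length u \<and> wprod ws = w"
    using map_fst_lists[OF u(1)] wprod_letter_values[OF u(1)]
    by (intro bexI[of _ "map fst u"]) auto
  from LeastI[of "\<lambda>k. \<exists>ws\<in>lists S. length ws = k \<and> wprod ws = w", OF this]
  show thesis using that by (auto simp: coxeter_length_def)
qed

lemma len_le: "set u \<subseteq> S \<Longrightarrow> len (wprod u) \<le> length u"
  unfolding coxeter_length_def by (rule Least_le) (auto intro!: bexI[of _ u])

text \<open>A word \<open>s\<^sub>1 \<dots> s\<^sub>d\<close> passes through the reflections \<open>s\<^sub>d \<dots> s\<^sub>i \<dots> s\<^sub>d\<close>; the predicate says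
  whether a given element occurs among them an odd number of times.  Unlike the list of
  reflections, this parity depends only on the element of the group, not on the word.\<close>

fun odd_reflection :: "'w list \<Rightarrow> 'w \<Rightarrow> bool" where
  "odd_reflection [] t \<longleftrightarrow> False"
| "odd_reflection (s # u) t \<longleftrightarrow> ((inv (wprod u) \<otimes> s \<otimes> wprod u = t) \<noteq> odd_reflection u t)"

lemma conj_eq_iff:
  assumes "x \<in> carrier W" "y \<in> carrier W" "t \<in> carrier W"
  shows "inv y \<otimes> x \<otimes> y = t \<longleftrightarrow> x = y \<otimes> t \<otimes> inv y"
proof -
  have "inv y \<otimes> x \<otimes> y = t \<longleftrightarrow> inv y \<otimes> (x \<otimes> y) = t" using assms by (simp add: m_assoc)
  also have "\<dots> \<longleftrightarrow> x \<otimes> y = y \<otimes> t"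
    using inv_solve_left[of t y "x \<otimes> y"] assms by (metis m_closed)
  also have "\<dots> \<longleftrightarrow> x = y \<otimes> t \<otimes> inv y"
    using inv_solve_right[of x "y \<otimes> t" y] assms by (metis m_closed)
  finally show ?thesis .
qed

lemma odd_reflection_append:
  assumes "set u \<subseteq> S" "set v \<subseteq> S" "t \<in> carrier W"
  shows "odd_reflection (u @ v) t \<longleftrightarrow>
    (odd_reflection u (wprod v \<otimes> t \<otimes> inv (wprod v)) \<noteq> odd_reflection v t)"
  using assms(1)
proof (induction u)
  case (Cons s u)
  have "inv (wprod u \<otimes> wprod v) \<otimes> s \<otimes> (wprod u \<otimes> wprod v)
      = inv (wprod v) \<otimes> (inv (wprod u) \<otimes> s \<otimes> wprod u) \<otimes> wprod v"
    using Cons.prems assms(2) by (simp add: inv_mult_group m_assoc)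
  then have "inv (wprod (u @ v)) \<otimes> s \<otimes> wprod (u @ v) = t \<longleftrightarrow>
      inv (wprod u) \<otimes> s \<otimes> wprod u = wprod v \<otimes> t \<otimes> inv (wprod v)"
    using Cons.prems assms(2,3)
      conj_eq_iff[of "inv (wprod u) \<otimes> s \<otimes> wprod u" "wprod v" t] by simp
  with Cons show ?case by auto
qed simp

lemma odd_reflection_insert:
  assumes "set u \<subseteq> S" "set x \<subseteq> S" "set v \<subseteq> S" "t \<in> carrier W"
    and "wprod x = \<one>" "\<And>r. r \<in> carrier W \<Longrightarrow> \<not> odd_reflection x r"
  shows "odd_reflection (u @ x @ v) t \<longleftrightarrow> odd_reflection (u @ v) t"
  using assms odd_reflection_append[of u "x @ v" t] odd_reflection_append[of x v t]
    odd_reflection_append[of u v t] by simp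

lemma wprod_replicate_pair:
  assumes "s \<in> S" "t \<in> S"
  shows "wprod (concat (replicate k [s, t])) = (s \<otimes> t) [^] k"
proof (induction k)
  case (Suc k)
  have "wprod (concat (replicate (Suc k) [s, t])) = s \<otimes> t \<otimes> (s \<otimes> t) [^] k"
    using assms by (simp add: Suc m_assoc del: nat_pow_Suc)
  also have "\<dots> = (s \<otimes> t) [^] Suc k" using assms by (simp only: nat_pow_Suc2 m_closed generator_closed)
  finally show ?case .
qed simp

text \<open>Since conjugation by \<open>t\<close> inverts \<open>a = s t\<close>, the letters \<open>t\<close> and \<open>s\<close> in front of the word \<open>a\<^sup>i\<close>
  contribute the reflections \<open>a\<^sup>-\<^sup>i t a\<^sup>i = t a\<^sup>2\<^sup>i\<close> and \<open>a\<^sup>-\<^sup>i t s t a\<^sup>i = t a\<^sup>2\<^sup>i\<^sup>+\<^sup>1\<close>.\<close>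

lemma odd_reflection_replicate_pair:
  assumes "s \<in> S" "t \<in> S" "r \<in> carrier W"
  shows "odd_reflection (concat (replicate k [s, t])) r \<longleftrightarrow>
    odd (\<Sum>i<2 * k. of_bool (t \<otimes> (s \<otimes> t) [^] i = r) :: nat)"
proof (induction k)
  case (Suc k)
  let ?a = "s \<otimes> t" and ?u = "concat (replicate k [s, t])"
  have S: "set ?u \<subseteq> S" using assms by auto
  have a: "?a \<in> carrier W" using assms by simp
  have inv_a: "inv ?a = t \<otimes> s" using assms by (simp add: inv_mult_group)
  have swap: "inv (?a [^] i) \<otimes> t = t \<otimes> ?a [^] i" for i :: nat
  proof (induction i)
    case (Suc i)
    have "inv (?a [^] Suc i) \<otimes> t = inv ?a \<otimes> (inv (?a [^] i) \<otimes> t)"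
      using assms by (simp add: inv_mult_group m_assoc)
    also have "\<dots> = t \<otimes> (?a \<otimes> ?a [^] i)"
      using assms by (simp add: Suc inv_a m_assoc)
    also have "\<dots> = t \<otimes> ?a [^] Suc i" using a by (simp only: nat_pow_Suc2)
    finally show ?case .
  qed (use assms in simp)
  have r1: "inv (wprod ?u) \<otimes> t \<otimes> wprod ?u = t \<otimes> ?a [^] (2 * k)"
  proof -
    have "inv (wprod ?u) \<otimes> t \<otimes> wprod ?u = t \<otimes> ?a [^] k \<otimes> ?a [^] k"
      using assms by (simp add: wprod_replicate_pair swap)
    then show ?thesis using assms a by (simp add: m_assoc nat_pow_mult mult_2)
  qed
  have r2: "inv (wprod (t # ?u)) \<otimes> s \<otimes> wprod (t # ?u) = t \<otimes> ?a [^] Suc (2 * k)"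
  proof -
    have "inv (wprod (t # ?u)) \<otimes> s \<otimes> wprod (t # ?u)
        = inv (?a [^] k) \<otimes> t \<otimes> (?a \<otimes> ?a [^] k)"
      using assms by (simp add: wprod_replicate_pair inv_mult_group m_assoc)
    also have "\<dots> = t \<otimes> ?a [^] k \<otimes> ?a [^] Suc k"
      using a by (simp only: swap nat_pow_Suc2)
    also have "\<dots> = t \<otimes> ?a [^] (k + Suc k)"
      using assms a by (simp only: m_assoc nat_pow_closed generator_closed nat_pow_mult)
    finally show ?thesis by (simp add: mult_2)
  qed
  have "odd_reflection (concat (replicate (Suc k) [s, t])) r \<longleftrightarrow>
      ((t \<otimes> ?a [^] Suc (2 * k) = r) \<noteq> ((t \<otimes> ?a [^] (2 * k) = r) \<noteq> odd_reflection ?u r))"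
    using r1 r2 by (simp del: wprod_simps nat_pow_Suc)
  then show ?case by (auto simp: Suc simp del: nat_pow_Suc)
qed simp

text \<open>Since \<open>t (s t)\<^sup>i\<close> has the period \<open>k\<close> in \<open>i\<close>, it takes each of its values an even number of times
  on \<open>i < 2 k\<close>.\<close>

lemma not_odd_reflection_relation:
  assumes "s \<in> S" "t \<in> S" "r \<in> carrier W" and ord: "(s \<otimes> t) [^] k = \<one>"
  shows "\<not> odd_reflection (concat (replicate k [s, t])) r"
proof -
  let ?g = "\<lambda>i. of_bool (t \<otimes> (s \<otimes> t) [^] i = r) :: nat"
  have period: "?g (k + i) = ?g i" for i
    using ord assms by (simp flip: nat_pow_mult)
  have "(\<Sum>i<k + m. ?g i) = (\<Sum>i<k. ?g i) + (\<Sum>i<m. ?g i)" for m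
    by (induction m) (simp_all add: period)
  from this[of k] have "even (\<Sum>i<2 * k. ?g i)" by (simp add: mult_2)
  then show ?thesis using odd_reflection_replicate_pair[OF assms(1-3)] by simp
qed

text \<open>Inserting a word with product \<open>1\<close> conjugates the reflections of the letters before it by \<open>1\<close>, and
  the words inserted by the rules of the presentation have no odd reflections of their own.\<close>

lemma odd_reflection_cong:
  assumes "set u \<subseteq> S" "set v \<subseteq> S" "wprod u = wprod v" "t \<in> carrier W"
  shows "odd_reflection u t \<longleftrightarrow> odd_reflection v t"
proof -
  obtain m where m: "coxeter_matrix_on S m"
    "\<And>u v. u \<in> lists (S \<times> UNIV) \<Longrightarrow> v \<in> lists (S \<times> UNIV) \<Longrightarrow>
       wprod (map (letter_value W) u) = wprod (map (letter_value W) v) \<longleftrightarrow> presentation_eq S m u v"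
    by (rule presentation) blast
  have inv: "odd_reflection (map fst x) t \<longleftrightarrow> odd_reflection (map fst y) t"
    if "presentation_eq S m x y" for x y
    using that
  proof induction
    case (cancel u v s b)
    then show ?case
      using odd_reflection_insert[of "map fst u" "[s, s]" "map fst v" t] map_fst_lists assms(4)
      by (auto simp: m_assoc)
  next
    case (relation u v s t' k)
    let ?x = "concat (replicate k [(s, True), (t', True)])"
    have fst: "map fst ?x = concat (replicate k [s, t'])"
      by (simp add: map_concat)
    have x: "?x \<in> lists (S \<times> UNIV)" using relation by (auto split: if_splits)
    have "presentation_eq S m ?x []"
      using presentation_eq.relation[of "[]" S "[]" s t' m k] relation(3-5) by simp
    then have "wprod (map (letter_value W) ?x) = wprod (map (letter_value W) [])"
      using m(2)[OF x, of "[]"] by simp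
    then have "wprod (map fst ?x) = \<one>" using wprod_letter_values[OF x] by simp
    then have "(s \<otimes> t') [^] k = \<one>"
      using relation by (simp only: fst wprod_replicate_pair)
    then have "odd_reflection (map fst u @ map fst ?x @ map fst v) t \<longleftrightarrow>
        odd_reflection (map fst u @ map fst v) t"
      using relation assms(4) map_fst_lists not_odd_reflection_relation[of s t' _ k] x
      unfolding fst
      by (intro odd_reflection_insert) (auto simp: wprod_replicate_pair)
    then show ?case by simp
  qed auto
  let ?e = "map (\<lambda>s. (s, True))"
  have lists: "?e u \<in> lists (S \<times> UNIV)" "?e v \<in> lists (S \<times> UNIV)" using assms by auto
  then have "presentation_eq S m (?e u) (?e v)"
    using assms(3) m(2)[OF lists] by (simp add: letter_value_def comp_def)
  from inv[OF this] show ?thesis by (simp add: comp_def)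
qed

text \<open>If \<open>t = u\<^sup>-\<^sup>1 s u\<close> for a letter \<open>s\<close> followed by the word \<open>u\<close>, then \<open>s u t = s s u = u\<close>, so that
  multiplication by \<open>t\<close> deletes this letter.\<close>

lemma odd_reflection_deletion:
  assumes "set u \<subseteq> S" "odd_reflection u t" "t \<in> carrier W"
  shows "\<exists>u'. subseq u' u \<and> Suc (length u') = length u \<and> wprod u' = wprod u \<otimes> t"
  using assms(1,2)
proof (induction u)
  case (Cons s u)
  then have S: "s \<in> S" "set u \<subseteq> S" by auto
  show ?case
  proof (cases "odd_reflection u t")
    case True
    then obtain u' where u': "subseq u' u" "Suc (length u') = length u" "wprod u' = wprod u \<otimes> t"
      using Cons S by blast
    then show ?thesis using S assms(3)
      by (intro exI[of _ "s # u'"]) (auto simp: m_assoc)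
  next
    case False
    then have t: "t = inv (wprod u) \<otimes> s \<otimes> wprod u" using Cons.prems by simp
    have "wprod u \<otimes> t = wprod u \<otimes> (inv (wprod u) \<otimes> (s \<otimes> wprod u))"
      using S by (simp add: t m_assoc)
    also have "\<dots> = (wprod u \<otimes> inv (wprod u)) \<otimes> (s \<otimes> wprod u)"
      by (rule m_assoc[symmetric]) (use S in simp_all)
    also have "\<dots> = s \<otimes> wprod u" using S by simp
    finally have "wprod (s # u) \<otimes> t = s \<otimes> (s \<otimes> wprod u)"
      using S assms(3) by (simp add: m_assoc)
    also have "\<dots> = (s \<otimes> s) \<otimes> wprod u" using S by (simp add: m_assoc del: generator_square)
    also have "\<dots> = wprod u" using S by simp
    finally show ?thesis
      by (intro exI[of _ u]) (auto intro: list_emb_Cons)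
  qed
qed simp

text \<open>A reduced word for \<open>w s\<close>, followed by \<open>s\<close>, passes an odd number of times through the
  reflection \<open>s\<close>, since otherwise two letters could be deleted from it.  Hence so does every
  other word for \<open>w\<close>.\<close>

lemma exchange:
  assumes u: "set u \<subseteq> S" "wprod u = w" "length u = len w" and s: "s \<in> S"
    and desc: "Suc (len (w \<otimes> s)) = len w"
  obtains u' where "subseq u' u" "wprod u' = w \<otimes> s" "length u' = len (w \<otimes> s)"
proof -
  have w: "w \<in> carrier W" using u by auto
  then have ws: "w \<otimes> s \<otimes> s = w" using s by (simp add: m_assoc)
  obtain v where v: "set v \<subseteq> S" "wprod v = w \<otimes> s" "length v = len (w \<otimes> s)"
    using w s by (metis reduced_word_exists generator_closed m_closed)
  have "\<not> odd_reflection v s"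
  proof
    assume "odd_reflection v s"
    then obtain v' where v': "subseq v' v" "Suc (length v') = length v" "wprod v' = wprod v \<otimes> s"
      using odd_reflection_deletion v s by (metis generator_closed)
    then have "wprod v' = w" using v ws by simp
    moreover have "set v' \<subseteq> S" using v'(1) v(1) by (auto simp: subseq_conv_nths dest: in_set_nthsD)
    ultimately have "len w \<le> length v'" using len_le by blast
    then show False using v' v desc by simp
  qed
  then have "odd_reflection (v @ [s]) s"
    using v s odd_reflection_append[of v "[s]" s] by simp
  moreover have "wprod (v @ [s]) = w" using v s w ws by simp
  ultimately have "odd_reflection u s"
    using odd_reflection_cong[of u "v @ [s]" s] u v s by simp
  from odd_reflection_deletion[OF u(1) this] s obtain u'
    where "subseq u' u" "Suc (length u') = length u" "wprod u' = wprod u \<otimes> s" by auto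
  then show thesis using that u desc by simp
qed

section \<open>Subwords representing an element\<close>

definition representing :: "'w list \<Rightarrow> 'w \<Rightarrow> nat set set" where
  "representing Q w = {P. represents W S Q P w}"

lemma nths_insert_length: "nths Q (insert (length Q) P) = nths Q P"
  unfolding nths_def by (intro arg_cong[where f = "map fst"] filter_cong) (auto simp: set_zip)

lemma nths_snoc:
  assumes "P \<subseteq> {..<length Q}"
  shows "nths (Q @ [s]) P = nths Q P" "nths (Q @ [s]) (insert (length Q) P) = nths Q P @ [s]"
  using assms by (auto simp: nths_append nths_insert_length)

lemma representing_snoc_cases:
  assumes "P \<in> representing (Q @ [s]) w" "set Q \<subseteq> S" "s \<in> S"
  obtains "P \<in> representing Q w"
  | P' where "P = insert (length Q) P'" "P' \<in> representing Q (w \<otimes> s)" "Suc (len (w \<otimes> s)) = len w"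
proof (cases "length Q \<in> P")
  case False
  then have "P \<subseteq> {..<length Q}"
    using assms(1) by (auto simp: representing_def represents_def less_Suc_eq)
  then show thesis using that(1) assms(1)
    by (simp add: representing_def represents_def nths_snoc)
next
  case True
  define P' where "P' = P - {length Q}"
  have P: "P = insert (length Q) P'" "P' \<subseteq> {..<length Q}"
    using True assms(1) by (auto simp: P'_def representing_def represents_def less_Suc_eq)
  have S: "set (nths Q P') \<subseteq> S" using assms(2) set_nths_subset by fast
  have w: "w = wprod (nths Q P') \<otimes> s" "len w = Suc (length (nths Q P'))"
    using assms(1) P S \<open>s \<in> S\<close> by (auto simp: representing_def represents_def nths_snoc)
  then have ws: "w \<otimes> s = wprod (nths Q P')" using S \<open>s \<in> S\<close> by (simp add: m_assoc)
  obtain v where v: "set v \<subseteq> S" "wprod v = w \<otimes> s" "length v = len (w \<otimes> s)"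
    using S ws by (metis reduced_word_exists wprod_closed)
  have "wprod (v @ [s]) = w" using v ws w S \<open>s \<in> S\<close> by simp
  then have "len w \<le> Suc (len (w \<otimes> s))"
    using len_le[of "v @ [s]"] v \<open>s \<in> S\<close> by simp
  moreover have "len (w \<otimes> s) \<le> length (nths Q P')" using len_le[OF S] ws by simp
  ultimately show thesis
    using that(2)[OF P(1)] P w ws by (simp add: representing_def represents_def)
qed

lemma representing_snoc_descent:
  assumes "set Q \<subseteq> S" "s \<in> S" "w \<in> carrier W" "Suc (len (w \<otimes> s)) = len w"
  shows "representing (Q @ [s]) w =
    representing Q w \<union> insert (length Q) ` representing Q (w \<otimes> s)"
proof
  show "representing (Q @ [s]) w \<subseteq> representing Q w \<union> insert (length Q) ` representing Q (w \<otimes> s)"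
    using assms by (auto elim!: representing_snoc_cases)
  have "P \<in> representing (Q @ [s]) w" if "P \<in> representing Q w" for P
    using that by (auto simp: representing_def represents_def nths_snoc)
  moreover have "insert (length Q) P \<in> representing (Q @ [s]) w"
    if "P \<in> representing Q (w \<otimes> s)" for P
  proof -
    have P: "P \<subseteq> {..<length Q}" "wprod (nths Q P) = w \<otimes> s" "length (nths Q P) = len (w \<otimes> s)"
      using that by (auto simp: representing_def represents_def)
    have "set (nths Q P) \<subseteq> S" using assms(1) set_nths_subset by fast
    then show ?thesis using P assms
      by (auto simp: representing_def represents_def nths_snoc m_assoc)
  qed
  ultimately show "representing Q w \<union> insert (length Q) ` representing Q (w \<otimes> s)
      \<subseteq> representing (Q @ [s]) w" by auto
qed

lemma representing_snoc_no_descent: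
  assumes "set Q \<subseteq> S" "s \<in> S" "Suc (len (w \<otimes> s)) \<noteq> len w"
  shows "representing (Q @ [s]) w = representing Q w"
  using assms
  by (auto elim!: representing_snoc_cases) (auto simp: representing_def represents_def nths_snoc)

lemma representing_refine:
  assumes "set Q \<subseteq> S" "s \<in> S" "Suc (len (w \<otimes> s)) = len w" "P \<in> representing Q w"
  obtains P' where "P' \<in> representing Q (w \<otimes> s)" "P' \<subseteq> P"
proof -
  have P: "P \<subseteq> {..<length Q}" "wprod (nths Q P) = w" "length (nths Q P) = len w"
    using assms by (auto simp: representing_def represents_def)
  moreover have "set (nths Q P) \<subseteq> S" using assms(1) set_nths_subset by fast
  ultimately obtain u where "subseq u (nths Q P)" "wprod u = w \<otimes> s" "length u = len (w \<otimes> s)"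
    using exchange assms by metis
  moreover from this(1) obtain P' where "P' \<subseteq> P" "u = nths Q P'" by (rule subseq_nths_obtain)
  ultimately show thesis
    using that P(1) by (auto simp: representing_def represents_def)
qed

lemma representing_empty:
  assumes "length Q < len w"
  shows "representing Q w = {}"
proof -
  have "length (nths Q P) \<le> length Q" for P
    using subseq_conv_nths list_emb_length by blast
  then have "length (nths Q P) \<noteq> len w" for P
    using assms by (metis not_less)
  then show ?thesis by (simp add: representing_def represents_def)
qed

end

section \<open>Squarefree monomial ideals\<close>

type_synonym 'k polynomial = "(nat \<Rightarrow>\<^sub>0 nat) \<Rightarrow>\<^sub>0 'k"

lemma mpoly_coefficient_ring:
  "coefficient_ring (carrier (mpoly_ring n) :: 'k::field polynomial set)"
proof
  show "0 \<in> carrier (mpoly_ring n)" "1 \<in> carrier (mpoly_ring n)"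
    by (simp_all add: mpoly_carrier_iff)
  show "- a \<in> carrier (mpoly_ring n)" if "a \<in> carrier (mpoly_ring n)" for a :: "'k polynomial"
    using that by (simp add: mpoly_carrier_iff in_keys_iff)
qed (auto intro: mpoly_add_closed mpoly_mult_closed)

interpretation mpoly: coefficient_ring "carrier (mpoly_ring n) :: 'k::field polynomial set" for n
  by (rule mpoly_coefficient_ring)

text \<open>The ideal generated by the squarefree monomials of the sets in \<open>G\<close> (see \<open>genideal_xmonom\<close>
  below).  Describing it through the supports of its elements reduces sums and colon ideals to
  statements about single monomials.\<close>

definition monomial_ideal :: "nat \<Rightarrow> nat set set \<Rightarrow> 'k::field polynomial set" where
  "monomial_ideal n G = {p \<in> carrier (mpoly_ring n).
     \<forall>m\<in>Poly_Mapping.keys p. \<exists>P\<in>G. P \<subseteq> Poly_Mapping.keys m}"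

lemma keys_add_nat:
  "Poly_Mapping.keys (a + b :: nat \<Rightarrow>\<^sub>0 nat) = Poly_Mapping.keys a \<union> Poly_Mapping.keys b"
  by (auto simp: in_keys_iff lookup_add)

lemma polynomial_as_sum:
  fixes p :: "'a \<Rightarrow>\<^sub>0 'k::comm_monoid_add"
  shows "p = (\<Sum>m\<in>Poly_Mapping.keys p. Poly_Mapping.single m (Poly_Mapping.lookup p m))"
proof (rule poly_mapping_eqI)
  fix k
  show "Poly_Mapping.lookup p k = Poly_Mapping.lookup
      (\<Sum>m\<in>Poly_Mapping.keys p. Poly_Mapping.single m (Poly_Mapping.lookup p m)) k"
    by (simp add: lookup_sum lookup_single when_def sum.delta in_keys_iff)
qed

lemma polynomial_in_additive_set:
  fixes p :: "'a \<Rightarrow>\<^sub>0 'k::comm_monoid_add"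
  assumes "0 \<in> T" "\<And>x y. x \<in> T \<Longrightarrow> y \<in> T \<Longrightarrow> x + y \<in> T"
    and "\<And>m. m \<in> Poly_Mapping.keys p \<Longrightarrow> Poly_Mapping.single m (Poly_Mapping.lookup p m) \<in> T"
  shows "p \<in> T"
proof -
  have "(\<Sum>m\<in>A. Poly_Mapping.single m (Poly_Mapping.lookup p m)) \<in> T"
    if "A \<subseteq> Poly_Mapping.keys p" for A
    using that by (induction A rule: infinite_finite_induct) (auto simp: assms)
  from this[OF order_refl] show ?thesis by (subst polynomial_as_sum)
qed

lemma lookup_single_times:
  fixes p :: "'a::cancel_comm_monoid_add \<Rightarrow>\<^sub>0 'k::comm_semiring_1"
  shows "Poly_Mapping.lookup (Poly_Mapping.single a 1 * p) (a + m) = Poly_Mapping.lookup p m"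
proof -
  have "Poly_Mapping.single a 1 * p = Poly_Mapping.single a 1 *
      (\<Sum>k\<in>Poly_Mapping.keys p. Poly_Mapping.single k (Poly_Mapping.lookup p k))"
    by (rule arg_cong[OF polynomial_as_sum])
  also have "\<dots> =
      (\<Sum>k\<in>Poly_Mapping.keys p. Poly_Mapping.single (a + k) (Poly_Mapping.lookup p k))"
    by (simp add: sum_distrib_left mult_single)
  finally have "Poly_Mapping.single a 1 * p = \<dots>" .
  then show ?thesis
    by (simp add: lookup_sum lookup_single when_def sum.delta in_keys_iff)
qed

definition squarefree_exponent :: "nat set \<Rightarrow> nat \<Rightarrow>\<^sub>0 nat" where
  "squarefree_exponent P = (\<Sum>i\<in>P. Poly_Mapping.single i 1)"

lemma lookup_squarefree_exponent:
  "finite P \<Longrightarrow> Poly_Mapping.lookup (squarefree_exponent P) i = (if i \<in> P then 1 else 0)"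
  by (simp add: squarefree_exponent_def lookup_sum lookup_single when_def sum.delta)

lemma keys_squarefree_exponent:
  "finite P \<Longrightarrow> Poly_Mapping.keys (squarefree_exponent P) = P"
  by (auto simp: in_keys_iff lookup_squarefree_exponent split: if_splits)

lemma xmonom_eq_single:
  "finite P \<Longrightarrow> (xmonom P :: 'k::field polynomial) = Poly_Mapping.single (squarefree_exponent P) 1"
  by (induction P rule: finite_induct)
    (simp_all add: xmonom_def squarefree_exponent_def pvar_def mult_single)

lemma diff_add_exponent:
  fixes a m :: "nat \<Rightarrow>\<^sub>0 nat"
  assumes "\<And>i. Poly_Mapping.lookup a i \<le> Poly_Mapping.lookup m i"
  shows "m - a + a = m"
  by (rule poly_mapping_eqI) (simp add: lookup_add lookup_minus assms)

lemma keys_diff_subset: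
  "Poly_Mapping.keys (m - a :: nat \<Rightarrow>\<^sub>0 nat) \<subseteq> Poly_Mapping.keys m"
  by (auto simp: in_keys_iff lookup_minus)

lemma monomial_ideal_zero: "0 \<in> monomial_ideal n G"
  by (simp add: monomial_ideal_def mpoly_carrier_iff)

lemma monomial_ideal_closed: "monomial_ideal n G \<subseteq> carrier (mpoly_ring n)"
  by (auto simp: monomial_ideal_def)

lemma monomial_ideal_add:
  "p \<in> monomial_ideal n G \<Longrightarrow> q \<in> monomial_ideal n G \<Longrightarrow> p + q \<in> monomial_ideal n G"
  using Poly_Mapping.keys_add[of p q] by (auto simp: monomial_ideal_def intro: mpoly_add_closed)

lemma monomial_ideal_mult:
  assumes "a \<in> carrier (mpoly_ring n)" "p \<in> monomial_ideal n G"
  shows "a * p \<in> monomial_ideal n G"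
proof -
  have "\<exists>P\<in>G. P \<subseteq> Poly_Mapping.keys m" if "m \<in> Poly_Mapping.keys (a * p)" for m
  proof -
    obtain k l where m: "m = k + l" "l \<in> Poly_Mapping.keys p"
      using \<open>m \<in> _\<close> keys_mult[of a p] by blast
    then obtain P where "P \<in> G" "P \<subseteq> Poly_Mapping.keys l"
      using assms(2) by (auto simp: monomial_ideal_def)
    then show ?thesis by (auto simp: m keys_add_nat)
  qed
  then show ?thesis
    using assms mpoly_mult_closed[of a n p] by (simp add: monomial_ideal_def)
qed

lemma ideal_in_monomial_ideal: "mpoly.ideal_in n (monomial_ideal n G)"
  unfolding mpoly.ideal_in_def
  by (simp add: monomial_ideal_add monomial_ideal_mult monomial_ideal_zero monomial_ideal_closed)

lemma ideal_monomial_ideal: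
  "ideal (monomial_ideal n G :: 'k::field polynomial set) (mpoly_ring n)"
proof -
  interpret R: cring "mpoly_ring n :: 'k polynomial ring" by (rule mpoly_ring_cring)
  show ?thesis
  proof (rule idealI)
    show "subgroup (monomial_ideal n G :: 'k polynomial set) (add_monoid (mpoly_ring n))"
    proof (rule R.add.subgroupI)
      show "monomial_ideal n G \<noteq> {}" using monomial_ideal_zero by blast
      fix p :: "'k polynomial" assume p: "p \<in> monomial_ideal n G"
      then have neg: "- 1 * p \<in> monomial_ideal n G"
        by (intro monomial_ideal_mult mpoly.uminus_closed mpoly.one_closed)
      have "\<ominus>\<^bsub>mpoly_ring n\<^esub> p = - 1 * p"
        using p neg monomial_ideal_closed by (intro R.minus_equality) auto
      with neg show "\<ominus>\<^bsub>mpoly_ring n\<^esub> p \<in> monomial_ideal n G" by simp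
    qed (use monomial_ideal_closed monomial_ideal_add in auto)
    fix p a :: "'k polynomial"
    assume "p \<in> monomial_ideal n G" "a \<in> carrier (mpoly_ring n)"
    then have "a * p \<in> monomial_ideal n G" by (intro monomial_ideal_mult)
    then show "a \<otimes>\<^bsub>mpoly_ring n\<^esub> p \<in> monomial_ideal n G"
      "p \<otimes>\<^bsub>mpoly_ring n\<^esub> a \<in> monomial_ideal n G"
      by (simp_all add: mult.commute)
  qed (rule R.ring_axioms)
qed

lemma genideal_xmonom:
  assumes "\<And>P. P \<in> G \<Longrightarrow> P \<subseteq> {..<n}"
  shows "genideal (mpoly_ring n) {xmonom P :: 'k::field polynomial | P. P \<in> G} = monomial_ideal n G"
    (is "genideal ?R ?X = _")
proof
  interpret R: cring ?R by (rule mpoly_ring_cring)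
  have fin: "finite P" if "P \<in> G" for P using assms[OF that] finite_subset by blast
  have X: "?X \<subseteq> carrier ?R" using assms by (auto intro: xmonom_closed)
  interpret I: ideal "genideal ?R ?X" ?R by (rule R.genideal_ideal[OF X])
  have "?X \<subseteq> monomial_ideal n G"
    using X fin by (auto simp: monomial_ideal_def xmonom_eq_single keys_squarefree_exponent)
  then show "genideal ?R ?X \<subseteq> monomial_ideal n G"
    by (rule R.genideal_minimal[OF ideal_monomial_ideal])
  show "monomial_ideal n G \<subseteq> genideal ?R ?X"
  proof
    fix p :: "'k polynomial" assume p: "p \<in> monomial_ideal n G"
    show "p \<in> genideal ?R ?X"
    proof (rule polynomial_in_additive_set)
      show "0 \<in> genideal ?R ?X" using I.zero_closed by simp
      show "x + y \<in> genideal ?R ?X" if "x \<in> genideal ?R ?X" "y \<in> genideal ?R ?X" for x y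
        using I.a_closed[OF that] by simp
      fix m assume m: "m \<in> Poly_Mapping.keys p"
      then obtain P where P: "P \<in> G" "P \<subseteq> Poly_Mapping.keys m"
        using p by (auto simp: monomial_ideal_def)
      let ?q = "Poly_Mapping.single (m - squarefree_exponent P) (Poly_Mapping.lookup p m)"
      have "m - squarefree_exponent P + squarefree_exponent P = m"
        using P fin[OF P(1)]
        by (intro diff_add_exponent) (auto simp: lookup_squarefree_exponent in_keys_iff Suc_le_eq)
      then have "Poly_Mapping.single m (Poly_Mapping.lookup p m) = ?q * xmonom P"
        using fin[OF P(1)] by (simp add: xmonom_eq_single mult_single)
      moreover have "xmonom P \<in> genideal ?R ?X"
        using R.genideal_self[OF X] P(1) by blast
      moreover have "?q \<in> carrier ?R"
        using p m keys_diff_subset[of m "squarefree_exponent P"]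
        by (auto simp: mpoly_carrier_iff monomial_ideal_def)
      ultimately show "Poly_Mapping.single m (Poly_Mapping.lookup p m) \<in> genideal ?R ?X"
        using I.I_l_closed by simp
    qed
  qed
qed

lemma monomial_ideal_mono:
  assumes "\<And>P. P \<in> G \<Longrightarrow> \<exists>P'\<in>H. P' \<subseteq> P"
  shows "monomial_ideal n G \<subseteq> monomial_ideal n H"
proof
  fix p assume p: "p \<in> monomial_ideal n G"
  show "p \<in> monomial_ideal n H"
    unfolding monomial_ideal_def mem_Collect_eq
  proof (intro conjI ballI)
    show "p \<in> carrier (mpoly_ring n)" using p monomial_ideal_closed by (rule rev_subsetD)
    fix m assume "m \<in> Poly_Mapping.keys p"
    then obtain P where P: "P \<in> G" "P \<subseteq> Poly_Mapping.keys m"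
      using p unfolding monomial_ideal_def mem_Collect_eq by metis
    from assms[OF P(1)] P(2) show "\<exists>P\<in>H. P \<subseteq> Poly_Mapping.keys m"
      by (meson order_trans)
  qed
qed

lemma monomial_ideal_empty: "monomial_ideal n {} = {0}"
proof -
  have "p = 0" if "p \<in> monomial_ideal n {}" for p :: "'a polynomial"
  proof -
    have "Poly_Mapping.keys p = {}" using that by (simp add: monomial_ideal_def)
    then show ?thesis by simp
  qed
  then show ?thesis using monomial_ideal_zero by blast
qed

lemma pvar_closed: "v < n \<Longrightarrow> pvar v \<in> carrier (mpoly_ring n)"
  by (auto simp: pvar_def mpoly_carrier_iff)

text \<open>A monomial prime to the variable \<open>x v\<close> divides \<open>x v * m\<close> only if it divides \<open>m\<close>.\<close>

lemma monomial_ideal_colon_variable: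
  assumes "\<And>P. P \<in> G \<Longrightarrow> v \<notin> P" "p \<in> carrier (mpoly_ring n)"
    and "pvar v * p \<in> monomial_ideal n G"
  shows "p \<in> monomial_ideal n G"
proof -
  have "\<exists>P\<in>G. P \<subseteq> Poly_Mapping.keys m" if m: "m \<in> Poly_Mapping.keys p" for m
  proof -
    let ?m = "Poly_Mapping.single v 1 + m"
    have "?m \<in> Poly_Mapping.keys (pvar v * p)"
      using m unfolding in_keys_iff pvar_def lookup_single_times .
    then obtain P where "P \<in> G" "P \<subseteq> Poly_Mapping.keys ?m"
      using assms(3) unfolding monomial_ideal_def mem_Collect_eq by metis
    moreover have "Poly_Mapping.keys ?m = insert v (Poly_Mapping.keys m)"
      by (simp add: keys_add_nat)
    ultimately have "P \<subseteq> Poly_Mapping.keys m" using assms(1)[of P] by auto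
    with \<open>P \<in> G\<close> show ?thesis by blast
  qed
  with assms(2) show ?thesis unfolding monomial_ideal_def mem_Collect_eq by blast
qed

lemma monomial_ideal_insert_variable:
  assumes "v < n" "\<And>P. P \<in> H \<Longrightarrow> v \<notin> P"
  shows "monomial_ideal n (G \<union> insert v ` H) =
    {pvar v * j + k :: 'k::field polynomial | j k.
       j \<in> monomial_ideal n H \<and> k \<in> monomial_ideal n G}" (is "?I = ?T")
proof
  show "?T \<subseteq> ?I"
  proof clarify
    fix j k :: "'k polynomial"
    assume j: "j \<in> monomial_ideal n H" and k: "k \<in> monomial_ideal n G"
    have "\<exists>P\<in>G \<union> insert v ` H. P \<subseteq> Poly_Mapping.keys m"
      if m: "m \<in> Poly_Mapping.keys (pvar v * j)" for m
    proof -
      obtain l where l: "m = Poly_Mapping.single v 1 + l" "l \<in> Poly_Mapping.keys j"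
        using m keys_mult[of "pvar v" j] by (auto simp: pvar_def)
      then obtain P where "P \<in> H" "P \<subseteq> Poly_Mapping.keys l"
        using j by (auto simp: monomial_ideal_def)
      then show ?thesis
        by (intro bexI[of _ "insert v P"]) (auto simp: l keys_add_nat)
    qed
    moreover have "pvar v * j \<in> carrier (mpoly_ring n)"
      using j pvar_closed[OF assms(1)] by (auto simp: monomial_ideal_def intro: mpoly_mult_closed)
    ultimately have "pvar v * j \<in> ?I" unfolding monomial_ideal_def mem_Collect_eq by blast
    moreover have "k \<in> ?I" using k by (rule subsetD[OF monomial_ideal_mono, rotated]) blast
    ultimately show "pvar v * j + k \<in> ?I" by (rule monomial_ideal_add)
  qed
  show "?I \<subseteq> ?T"
  proof
    fix p assume p: "p \<in> ?I"
    show "p \<in> ?T"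
    proof (rule polynomial_in_additive_set)
      show "0 \<in> ?T" using monomial_ideal_zero by (auto intro!: exI[of _ 0])
      show "x + y \<in> ?T" if xy: "x \<in> ?T" "y \<in> ?T" for x y
      proof -
        obtain j k j' k' where "x = pvar v * j + k" "y = pvar v * j' + k'"
          "j \<in> monomial_ideal n H" "j' \<in> monomial_ideal n H"
          "k \<in> monomial_ideal n G" "k' \<in> monomial_ideal n G"
          using xy by auto
        moreover from this have "x + y = pvar v * (j + j') + (k + k')" by (simp add: algebra_simps)
        ultimately show ?thesis using monomial_ideal_add by blast
      qed
      fix m assume m: "m \<in> Poly_Mapping.keys p"
      let ?c = "Poly_Mapping.lookup p m"
      have m_n: "Poly_Mapping.keys m \<subseteq> {..<n}"
        using p m by (auto simp: monomial_ideal_def mpoly_carrier_iff)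
      obtain P where "P \<in> G \<union> insert v ` H" "P \<subseteq> Poly_Mapping.keys m"
        using p m unfolding monomial_ideal_def mem_Collect_eq by metis
      then consider "P \<in> G" "P \<subseteq> Poly_Mapping.keys m"
        | P' where "P' \<in> H" "insert v P' \<subseteq> Poly_Mapping.keys m" by blast
      then show "Poly_Mapping.single m ?c \<in> ?T"
      proof cases
        case 1
        then have "Poly_Mapping.single m ?c \<in> monomial_ideal n G"
          using m_n by (auto simp: monomial_ideal_def mpoly_carrier_iff)
        moreover have "Poly_Mapping.single m ?c = pvar v * 0 + Poly_Mapping.single m ?c" by simp
        ultimately show ?thesis using monomial_ideal_zero by blast
      next
        case 2
        let ?l = "m - Poly_Mapping.single v 1"
        have "?l + Poly_Mapping.single v 1 = m"
          using 2(2) by (intro diff_add_exponent)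
            (auto simp: lookup_single when_def in_keys_iff Suc_le_eq)
        then have eq: "Poly_Mapping.single m ?c = pvar v * Poly_Mapping.single ?l ?c + 0"
          by (simp add: pvar_def mult_single add.commute)
        have "P' \<subseteq> Poly_Mapping.keys ?l"
          using 2(2) assms(2)[OF 2(1)]
          by (auto simp: subset_iff in_keys_iff lookup_minus lookup_single when_def)
        then have "Poly_Mapping.single ?l ?c \<in> monomial_ideal n H"
          using m_n 2(1) keys_diff_subset[of m "Poly_Mapping.single v 1"]
          by (auto simp: monomial_ideal_def mpoly_carrier_iff)
        then show ?thesis using eq monomial_ideal_zero by blast
      qed
    qed
  qed
qed

section \<open>The resolution of the ideal of a word\<close>

context coxeter_group
begin

lemma len_one: "len \<one> = 0"
  using len_le[of "[]"] by simp

text \<open>Induction on the word: if \<open>s\<close> is not a right descent of \<open>w\<close>, its last letter \<open>s\<close> is in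
  no representing subword; otherwise the exchange condition provides the inclusion of ideals that
  the cone construction needs.  Words shorter than \<open>w\<close> give the zero
  ideal, in accordance with the truncated subtraction.\<close>

lemma resolved_by_representing:
  assumes "set Q \<subseteq> S" "length Q \<le> n" "w \<in> carrier W"
  shows "mpoly.resolved_by n (Suc (length Q) - len w)
    (mpoly.embed ` (monomial_ideal n (representing Q w) :: 'k::field polynomial set))"
  using assms
proof (induction Q arbitrary: w rule: rev_induct)
  case Nil
  show ?case
  proof (cases "w = \<one>")
    case True
    then have "representing [] w = {{}}"
      by (auto simp: representing_def represents_def len_one)
    then have "monomial_ideal n (representing [] w) = (carrier (mpoly_ring n) :: 'k polynomial set)"
      by (auto simp: monomial_ideal_def)
    then show ?thesis using mpoly.resolved_by_whole_ring True by (simp add: len_one)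
  next
    case False
    then have "representing [] w = {}" by (auto simp: representing_def represents_def)
    then show ?thesis using mpoly.resolved_by_zero
      by (simp add: monomial_ideal_empty del: One_nat_def)
  qed
next
  case (snoc s Q)
  then have Q: "set Q \<subseteq> S" "s \<in> S" "length Q < n" and w: "w \<in> carrier W" by auto
  have IH: "mpoly.resolved_by n (Suc (length Q) - len u)
      (mpoly.embed ` (monomial_ideal n (representing Q u) :: 'k polynomial set))"
    if "u \<in> carrier W" for u
    using snoc.IH[OF Q(1) _ that] Q(3) by simp
  consider "Suc (len (w \<otimes> s)) \<noteq> len w" | "length (Q @ [s]) < len w"
    | "Suc (len (w \<otimes> s)) = len w" "len w \<le> Suc (length Q)" by fastforce
  then show ?case
  proof cases
    case 1
    have "Suc (length Q) - len w \<le> Suc (length (Q @ [s])) - len w" by simp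
    from mpoly.resolved_by_mono[OF this IH[OF w]] show ?thesis
      by (simp only: representing_snoc_no_descent[OF Q(1,2) 1])
  next
    case 2
    then show ?thesis
      using representing_empty[OF 2] mpoly.resolved_by_zero by (simp add: monomial_ideal_empty)
  next
    case 3
    define d where "d = Suc (length Q) - len w"
    have d: "Suc (length Q) - len (w \<otimes> s) = Suc d" "Suc (length (Q @ [s])) - len w = Suc d"
      using 3 by (auto simp: d_def)
    define J K :: "'k polynomial set"
      where "J = monomial_ideal n (representing Q (w \<otimes> s))"
        and "K = monomial_ideal n (representing Q w)"
    have fresh: "length Q \<notin> P" if "P \<in> representing Q u" for P u
      using that by (auto simp: representing_def represents_def)
    have "mpoly.resolved_by n (Suc d)
        (mpoly.embed ` {pvar (length Q) * j + k | j k. j \<in> J \<and> k \<in> K})"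
    proof (rule mpoly.resolved_by_ideal_cone)
      show "mpoly.ideal_in n J" "mpoly.ideal_in n K"
        unfolding J_def K_def by (rule ideal_in_monomial_ideal)+
      show "K \<subseteq> J" unfolding J_def K_def
      proof (rule monomial_ideal_mono)
        fix P assume "P \<in> representing Q w"
        from representing_refine[OF Q(1,2) 3(1) this]
        obtain P' where "P' \<in> representing Q (w \<otimes> s)" "P' \<subseteq> P" .
        then show "\<exists>P'\<in>representing Q (w \<otimes> s). P' \<subseteq> P" ..
      qed
      show "pvar (length Q) \<in> carrier (mpoly_ring n)" by (rule pvar_closed[OF Q(3)])
      show "j \<in> K" if "j \<in> J" "pvar (length Q) * j \<in> K" for j
        unfolding K_def
      proof (rule monomial_ideal_colon_variable)
        show "length Q \<notin> P" if "P \<in> representing Q w" for P using that by (rule fresh)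
        show "j \<in> carrier (mpoly_ring n)"
          using that(1) monomial_ideal_closed unfolding J_def by (rule rev_subsetD)
        show "pvar (length Q) * j \<in> monomial_ideal n (representing Q w)"
          using that(2) by (simp only: K_def)
      qed
      show "mpoly.resolved_by n (Suc d) (mpoly.embed ` J)"
        using IH[of "w \<otimes> s"] w Q(2) d(1) by (simp add: J_def)
      show "mpoly.resolved_by n d (mpoly.embed ` K)"
        using IH[OF w] by (simp add: K_def d_def)
    qed
    moreover have "monomial_ideal n (representing (Q @ [s]) w) =
        {pvar (length Q) * j + k | j k. j \<in> J \<and> k \<in> K}"
      unfolding J_def K_def representing_snoc_descent[OF Q(1,2) w 3(1)]
      using fresh Q(3) by (intro monomial_ideal_insert_variable)
    ultimately show ?thesis using d(2) by simp
  qed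
qed

end

section \<open>From iterated syzygies to projective resolutions\<close>

lemma free_module_simps [simp]:
  "zero (free_module R X) = (\<lambda>x. \<zero>\<^bsub>R\<^esub>)"
  "add (free_module R X) = (\<lambda>f g x. f x \<oplus>\<^bsub>R\<^esub> g x)"
  "smult (free_module R X) = (\<lambda>a f x. a \<otimes>\<^bsub>R\<^esub> f x)"
  by (simp_all add: free_module_def)

lemma free_module_carrier_iff:
  "f \<in> carrier (free_module R X) \<longleftrightarrow> (\<forall>x. f x \<in> carrier R) \<and>
     (\<forall>x. x \<notin> X \<longrightarrow> f x = \<zero>\<^bsub>R\<^esub>) \<and> finite {x. f x \<noteq> \<zero>\<^bsub>R\<^esub>}"
  by (simp add: free_module_def)

lemma (in cring) module_free_module: "Module.module R (free_module R X)"
proof (rule moduleI)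
  let ?F = "free_module R X"
  show "abelian_group ?F"
  proof (rule abelian_groupI)
    fix f g assume fg: "f \<in> carrier ?F" "g \<in> carrier ?F"
    have "finite ({x. f x \<noteq> \<zero>} \<union> {x. g x \<noteq> \<zero>})"
      using fg by (simp add: free_module_carrier_iff)
    then have "finite {x. f x \<oplus> g x \<noteq> \<zero>}" by (rule rev_finite_subset) auto
    with fg show "f \<oplus>\<^bsub>?F\<^esub> g \<in> carrier ?F" by (simp add: free_module_carrier_iff)
  next
    fix f assume f: "f \<in> carrier ?F"
    have "{x. \<ominus> f x \<noteq> \<zero>} \<subseteq> {x. f x \<noteq> \<zero>}" by auto
    then have "finite {x. \<ominus> f x \<noteq> \<zero>}"
      using f finite_subset by (auto simp: free_module_carrier_iff)
    with f have "(\<lambda>x. \<ominus> f x) \<in> carrier ?F" by (simp add: free_module_carrier_iff)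
    moreover have "(\<lambda>x. \<ominus> f x) \<oplus>\<^bsub>?F\<^esub> f = \<zero>\<^bsub>?F\<^esub>"
      using f by (simp add: free_module_carrier_iff l_neg)
    ultimately show "\<exists>g\<in>carrier ?F. g \<oplus>\<^bsub>?F\<^esub> f = \<zero>\<^bsub>?F\<^esub>"
      by (intro bexI[of _ "\<lambda>x. \<ominus> f x"])
  qed (auto simp: free_module_carrier_iff a_ac)
  fix a f assume af: "a \<in> carrier R" "f \<in> carrier ?F"
  have "{x. a \<otimes> f x \<noteq> \<zero>} \<subseteq> {x. f x \<noteq> \<zero>}" using af by auto
  then have "finite {x. a \<otimes> f x \<noteq> \<zero>}"
    using af finite_subset by (auto simp: free_module_carrier_iff)
  with af show "a \<odot>\<^bsub>?F\<^esub> f \<in> carrier ?F" by (simp add: free_module_carrier_iff)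
qed (auto simp: free_module_carrier_iff l_distr r_distr m_assoc is_cring)

text \<open>The basis is indexed by \<open>X\<close>, but \<^const>\<open>projective_module\<close> wants a basis drawn from the
  elements of the module; the standard basis vectors provide one.\<close>

lemma (in cring) projective_free_module:
  fixes X :: "'x set"
  assumes "\<one> \<noteq> \<zero>"
  shows "projective_module R (free_module R X)"
proof -
  define e :: "'x \<Rightarrow> 'x \<Rightarrow> 'a" where "e x = (\<lambda>y. if y = x then \<one> else \<zero>)" for x
  have inj: "inj e"
  proof (rule injI)
    fix x y assume "e x = e y"
    then have "e x x = e y x" by simp
    then show "x = y" using assms by (auto simp: e_def split: if_splits)
  qed
  define i where "i f = (\<lambda>p. if p \<in> e ` X then f (inv_into UNIV e p) else \<zero>)" for f :: "'x \<Rightarrow> 'a"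
  define r where "r g = (\<lambda>x. if x \<in> X then g (e x) else \<zero>)" for g :: "('x \<Rightarrow> 'a) \<Rightarrow> 'a"
  let ?F = "free_module R X" and ?G = "free_module R (e ` X)"
  have "i f \<in> carrier ?G" if f: "f \<in> carrier ?F" for f
  proof -
    have "{p. i f p \<noteq> \<zero>} \<subseteq> e ` {x. f x \<noteq> \<zero>}"
      using inj by (auto simp: i_def split: if_splits)
    then have "finite {p. i f p \<noteq> \<zero>}"
      using f finite_subset by (auto simp: free_module_carrier_iff)
    then show ?thesis using f by (auto simp: free_module_carrier_iff i_def)
  qed
  then have i: "i \<in> module_hom R ?F ?G" by (auto simp: module_hom_def i_def)
  have "r g \<in> carrier ?F" if g: "g \<in> carrier ?G" for g
  proof -
    have "finite (e -` {p. g p \<noteq> \<zero>})"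
      using g inj by (intro finite_vimageI) (auto simp: free_module_carrier_iff)
    then have "finite {x. r g x \<noteq> \<zero>}"
      by (rule rev_finite_subset) (auto simp: r_def)
    then show ?thesis using g by (auto simp: free_module_carrier_iff r_def)
  qed
  then have r: "r \<in> module_hom R ?G ?F" by (auto simp: module_hom_def r_def)
  have "r (i f) = f" if "f \<in> carrier ?F" for f
    using that inj by (auto simp: r_def i_def free_module_carrier_iff)
  with i r show ?thesis unfolding projective_module_def
    using module_free_module by blast
qed

text \<open>Coordinate vectors of length \<open>b\<close> are carried over to the free module on \<open>{0} \<times> {..<b}\<close>, whose
  underlying type is the one from which \<^const>\<open>proj_dim\<close> draws resolutions.\<close>

definition coords :: "('a::zero \<times> nat \<Rightarrow> 'b) \<Rightarrow> nat \<Rightarrow> 'b" where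
  "coords f = (\<lambda>j. f (0, j))"

definition from_coords :: "(nat \<Rightarrow> 'b) \<Rightarrow> 'a::zero \<times> nat \<Rightarrow> 'b::zero" where
  "from_coords g = (\<lambda>(a, j). if a = 0 then g j else 0)"

lemma coords_from_coords [simp]: "coords (from_coords g) = g"
  by (simp add: coords_def from_coords_def)

definition free_mpoly_module ::
    "nat \<Rightarrow> nat \<Rightarrow> ('k::field polynomial, 'k polynomial \<times> nat \<Rightarrow> 'k polynomial) module" where
  "free_mpoly_module n b = free_module (mpoly_ring n) ({0} \<times> {..<b})"

lemma free_mpoly_module_simps [simp]:
  "zero (free_mpoly_module n b) = (\<lambda>x. 0)"
  "add (free_mpoly_module n b) = (\<lambda>f g x. f x + g x)"
  "smult (free_mpoly_module n b) = (\<lambda>a f x. a * f x)"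
  by (simp_all add: free_mpoly_module_def)

lemma coords_free:
  assumes "f \<in> carrier (free_mpoly_module n b)"
  shows "coords f \<in> mpoly.free n b" "from_coords (coords f) = f"
  using assms
  by (auto simp: free_mpoly_module_def free_module_carrier_iff mpoly.free_def coords_def
    from_coords_def fun_eq_iff)

lemma from_coords_closed:
  assumes "g \<in> mpoly.free n b"
  shows "from_coords g \<in> carrier (free_mpoly_module n b)"
proof -
  have "{x. from_coords g x \<noteq> 0} \<subseteq> {0} \<times> {..<b}"
    using assms by (auto simp: mpoly.free_def from_coords_def not_less[symmetric] split: if_splits)
  then have "finite {x. from_coords g x \<noteq> 0}" by (rule finite_subset) simp
  then show ?thesis using assms
    by (auto simp: free_mpoly_module_def free_module_carrier_iff mpoly.free_def from_coords_def)
qed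

lemma coords_image: "coords ` carrier (free_mpoly_module n b) = mpoly.free n b"
  using coords_free(1) from_coords_closed coords_from_coords by (force intro: rev_image_eqI)

lemma coords_linear:
  "coords (\<lambda>x. f x + g x) = coords f + coords g" "coords (\<lambda>x. a * f x) = vec_scale a (coords f)"
  by (simp_all add: coords_def fun_eq_iff)

lemma from_coords_linear:
  "from_coords (f + g) = (\<lambda>x. from_coords f x + from_coords g x)"
  "from_coords (vec_scale a f) = (\<lambda>x. a * from_coords f x)"
  for a :: "'a::comm_ring_1"
  by (auto simp: from_coords_def fun_eq_iff)

lemma from_coords_eq_zero_iff: "from_coords g = (\<lambda>x. 0) \<longleftrightarrow> g = 0"
  by (auto simp: from_coords_def fun_eq_iff)

lemma projective_free_mpoly_module:
  "projective_module (mpoly_ring n) (free_mpoly_module n b)"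
  unfolding free_mpoly_module_def
  by (rule cring.projective_free_module[OF mpoly_ring_cring]) simp

text \<open>The differentials are the matrices of generators of the syzygies, transported to the free
  modules above; the augmentation reads off coordinate \<open>0\<close>, where the ideal is embedded.\<close>

lemma proj_dim_le_of_resolved_by:
  fixes I :: "'k::field polynomial set"
  assumes "mpoly.resolved_by n (Suc d) (mpoly.embed ` I)"
  shows "proj_dim (mpoly_ring n) (ideal_module (mpoly_ring n) I) \<le> enat d"
proof -
  let ?R = "mpoly_ring n :: 'k polynomial ring"
  obtain b :: "nat \<Rightarrow> nat" and v :: "nat \<Rightarrow> nat \<Rightarrow> nat \<Rightarrow> 'k polynomial"
    where b0: "\<And>i. i \<ge> Suc d \<Longrightarrow> b i = 0"
      and aug: "lincomb (b 0) (v 0) ` mpoly.free n (b 0) = mpoly.embed ` I"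
      and exact: "\<And>i. lincomb (b (Suc i)) (v (Suc i)) ` mpoly.free n (b (Suc i))
        = mpoly.relations n (b i) (v i)"
    using assms by (rule mpoly.resolved_by_imp_complex) blast
  define P where "P i = (free_mpoly_module n (b i)
    :: ('k polynomial, 'k polynomial \<times> nat \<Rightarrow> 'k polynomial) module)" for i
  define \<phi> :: "nat \<Rightarrow> ('k polynomial \<times> nat \<Rightarrow> 'k polynomial) \<Rightarrow> nat \<Rightarrow> 'k polynomial"
    where "\<phi> i f = lincomb (b i) (v i) (coords f)" for i f
  define \<delta> :: "nat \<Rightarrow> ('k polynomial \<times> nat \<Rightarrow> 'k polynomial) \<Rightarrow> 'k polynomial \<times> nat \<Rightarrow> 'k polynomial"
    where "\<delta> i f = from_coords (\<phi> (Suc i) f)" for i f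
  define e where "e f = \<phi> 0 f 0" for f
  have \<phi>_image: "\<phi> i ` carrier (P i) = lincomb (b i) (v i) ` mpoly.free n (b i)" for i
    unfolding \<phi>_def P_def coords_image[symmetric] image_image ..
  have \<phi>_linear: "\<phi> i (\<lambda>x. f x + g x) = \<phi> i f + \<phi> i g"
    "\<phi> i (\<lambda>x. a * f x) = vec_scale a (\<phi> i f)" for i f g a
    by (simp_all only: \<phi>_def coords_linear lincomb_add lincomb_scale)
  have kernel: "from_coords ` mpoly.relations n (b i) (v i) = {f \<in> carrier (P i). \<phi> i f = 0}" for i
  proof (intro subset_antisym subsetI)
    fix f :: "'k polynomial \<times> nat \<Rightarrow> 'k polynomial"
    assume "f \<in> from_coords ` mpoly.relations n (b i) (v i)"
    then show "f \<in> {f \<in> carrier (P i). \<phi> i f = 0}"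
      by (auto simp: mpoly.relations_def P_def \<phi>_def from_coords_closed)
  next
    fix f :: "'k polynomial \<times> nat \<Rightarrow> 'k polynomial"
    assume "f \<in> {f \<in> carrier (P i). \<phi> i f = 0}"
    then show "f \<in> from_coords ` mpoly.relations n (b i) (v i)"
      using coords_free[of f n "b i"]
      by (intro image_eqI[of _ _ "coords f"]) (auto simp: mpoly.relations_def P_def \<phi>_def)
  qed
  have \<delta>_image: "\<delta> i ` carrier (P (Suc i)) = {f \<in> carrier (P i). \<phi> i f = 0}" for i
  proof -
    have "\<delta> i ` carrier (P (Suc i)) = from_coords ` \<phi> (Suc i) ` carrier (P (Suc i))"
      unfolding image_image by (intro image_cong) (simp_all only: \<delta>_def)
    then show ?thesis by (simp only: \<phi>_image exact kernel)
  qed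
  have e_embed: "\<phi> 0 f = mpoly.embed (e f)" "e f \<in> I" if "f \<in> carrier (P 0)" for f
  proof -
    have "\<phi> 0 f \<in> mpoly.embed ` I" using that \<phi>_image[of 0] aug by blast
    then show "\<phi> 0 f = mpoly.embed (e f)" "e f \<in> I" by (auto simp: e_def)
  qed
  have "projective_resolution ?R (ideal_module ?R I) d P \<delta> e"
    unfolding projective_resolution_def
  proof (intro conjI allI impI)
    fix i
    show "projective_module ?R (P i)" unfolding P_def by (rule projective_free_mpoly_module)
    show "carrier (P i) = {\<zero>\<^bsub>P i\<^esub>}" if "i > d"
      using b0[of i] that
      by (auto simp: P_def free_mpoly_module_def free_module_carrier_iff)
    show "\<delta> i \<in> module_hom ?R (P (Suc i)) (P i)"
    proof -
      have "\<delta> i f \<in> carrier (P i)" if "f \<in> carrier (P (Suc i))" for f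
        using \<delta>_image[of i] that by blast
      moreover have "\<delta> i (\<lambda>x. f x + g x) = (\<lambda>x. \<delta> i f x + \<delta> i g x)"
        "\<delta> i (\<lambda>x. a * f x) = (\<lambda>x. a * \<delta> i f x)" for f g a
        by (simp_all only: \<delta>_def \<phi>_linear from_coords_linear)
      ultimately show ?thesis by (simp add: module_hom_def P_def)
    qed
    show "\<delta> (Suc i) ` carrier (P (Suc (Suc i))) = a_kernel (P (Suc i)) (P i) (\<delta> i)"
      unfolding \<delta>_image a_kernel_def'
      by (simp add: P_def \<delta>_def from_coords_eq_zero_iff)
  next
    have "e (\<lambda>x. f x + g x) = e f + e g" "e (\<lambda>x. a * f x) = a * e f" for f g a
      by (simp_all add: e_def \<phi>_linear)
    then show "e \<in> module_hom ?R (P 0) (ideal_module ?R I)"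
      using e_embed(2) by (simp add: module_hom_def ideal_module_def P_def)
    have "e ` carrier (P 0) = (\<lambda>g. g 0) ` \<phi> 0 ` carrier (P 0)" by (simp add: e_def image_image)
    also have "\<dots> = I" by (simp add: \<phi>_image aug image_image)
    finally show "e ` carrier (P 0) = carrier (ideal_module ?R I)"
      by (simp add: ideal_module_def)
    show "\<delta> 0 ` carrier (P 1) = a_kernel (P 0) (ideal_module ?R I) e"
      using \<delta>_image[of 0] e_embed(1) by (auto simp: a_kernel_def' ideal_module_def)
  qed
  then show ?thesis unfolding proj_dim_def by (intro Inf_lower) blast
qed

theorem theorem1p13:
  fixes W :: "('w, 'b) monoid_scheme" and S :: "'w set" and Q :: "'w list"
    and w :: 'w and n :: nat
    and I :: "((nat \<Rightarrow>\<^sub>0 nat) \<Rightarrow>\<^sub>0 'k::field) set"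
  assumes "coxeter_system W S"
    and "set Q \<subseteq> S" and "length Q = n"
    and "w \<in> carrier W" and "subword_contains W S Q {..<n} w"
    and "I = stanley_reisner_ideal n (alexander_dual n (subword_complex W S Q w))"
  shows "proj_dim (mpoly_ring n) (ideal_module (mpoly_ring n) I)
           \<le> enat (n - coxeter_length W S w)"
proof -
  interpret coxeter_group W S by (rule coxeter_group.intro) fact
  have "I = genideal (mpoly_ring n) {xmonom P | P. P \<in> representing Q w}"
    using stanley_reisner_dual_subword_complex[of Q W S w] assms(3,6)
    by (simp add: representing_def)
  also have "\<dots> = monomial_ideal n (representing Q w)"
    using assms(3) by (intro genideal_xmonom) (auto simp: representing_def represents_def)
  finally have I: "I = monomial_ideal n (representing Q w)" .
  have "mpoly.resolved_by n (Suc (length Q) - len w)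
      (mpoly.embed ` (monomial_ideal n (representing Q w) :: 'k polynomial set))"
    using assms(2-4) by (intro resolved_by_representing) simp_all
  moreover have "Suc (length Q) - len w = Suc (n - len w)"
    using coxeter_length_le[OF assms(5)] assms(3) by simp
  ultimately have "mpoly.resolved_by n (Suc (n - len w)) (mpoly.embed ` I)"
    by (simp only: I)
  then show ?thesis by (rule proj_dim_le_of_resolved_by)
qed

end
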